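(* Let $P_i$ and $E_j$ play the reach-avoid game described in the context, with speed ratio $\alpha=v_E/v_P\in(0,1)$. Assume all players have pairwise distinct initial positions, the pursuers' initial positions lie in $\Omega_{\rm play}\cup\mathcal T$, and the evaders' initial positions lie in $\Omega_{\rm play}$. If the pursuit coalition $k$ consists of the single pursuer $P_i$ with initial position $\mathbf x_{P_i}^0$ (so $\mathcal X_k^0=\mathbf x_{P_i}^0$), then its barrier against one evader is $$\mathcal B^1(\mathcal X_k^0)=\breve{\mathcal B}^1\cap\Omega_{\rm play},\qquad \breve{\mathcal B}^1=\bigcup_{s=1}^3\breve{\mathcal B}^1_s,\qquad \breve{\mathcal B}^1_s=F^1_s(\mathbf x_{P_i}^0)\ \ (s=1,2,3),$$ where $\breve{\mathcal B}^1$ is the barrier when the boundary of $\Omega_{\rm play}$ is ignored.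
   Context: Domain. $\Omega\subset\mathbb R^2$ is a bounded convex domain. A straight segment $\mathcal T\subset\Omega$ (the target line) with endpoints $\bm m=(0,0)$ and $\bm n=(l,0)$, $l>0$, both on $\partial\Omega$, cuts $\Omega$ into the compact target region $\Omega_{\rm tar}\supset\mathcal T$ (the part in $y\ge 0$) and the play region $\Omega_{\rm play}=\Omega\setminus\Omega_{\rm tar}$ (the part in $y<0$). Players. There are pursuers $P_1,\dots,P_{N_p}$ and evaders $E_1,\dots,E_{N_e}$, which are points moving in $\Omega$ with $\dot{\mathbf x}_{P_i}=v_P\mathbf u_{P_i}$, $\dot{\mathbf x}_{E_j}=v_E\mathbf u_{E_j}$, controls in $\mathcal U=\{\mathbf u\in\mathbb R^2:\|\mathbf u\|_2=1\}$, and initial positions $\mathbf x^0_{P_i},\mathbf x^0_{E_j}$; $\alpha=v_E/v_P$. An evader is captured when its position in $\Omega_{\rm play}$ coincides with that of a pursuer; once it enters $\Omega_{\rm tar}$ it can no longer be captured. Information structure: the evader uses state feedback; the pursuit team uses state feedback together with the evader's current input (non-anticipative strategies). Winning regions and barrier. A pursuit coalition $k$ is a nonempty set of $n_k$ pursuers with joint initial position $\mathcal X_k^0$. For a game between coalition $k$ and one evader: $\mathcal W_P^{n_k}(\mathcal X_k^0)\subset\Omega_{\rm play}$ is the set of initial evader positions from which the coalition can guarantee capture before the evader enters $\Omega_{\rm tar}$, whatever the evader does; $\mathcal W_E^{n_k}(\mathcal X_k^0)\subset\Omega_{\rm play}$ is the set of initial evader positions from which the evader can guarantee entering $\Omega_{\rm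 tar}$ without being captured, whatever the coalition does. The barrier $\mathcal B^{n_k}(\mathcal X_k^0)\subset\Omega_{\rm play}$ is the curve separating these two regions, i.e. the set of positions from which neither side can guarantee its own winning (under optimal play capture and arrival at $\mathcal T$ happen simultaneously), with $\mathcal B^{n_k}\cup\mathcal W_P^{n_k}\cup\mathcal W_E^{n_k}=\Omega_{\rm play}$. $\breve{\mathcal B}^{n_k}$ denotes the barrier of the same game when the boundary of $\Omega_{\rm play}$ is ignored (players move in $\mathbb R^2$, the evader starts in $\{y<0\}$ and wants to reach $\mathcal T$). Base curves. For $\bm h_1=(x_1,y_1)$ with $y_1\le 0$, put $k_1=\alpha^2x_1$, $k_2=(1-\alpha^2)l+\alpha^2x_1$ and $$F^1_1(\bm h_1)=\{\mathbf z=(x,y):\|\mathbf z-\bm m\|_2=\alpha\|\bm h_1-\bm m\|_2,\ x\le k_1,\ y<0\},$$ $$F^1_2(\bm h_1)=\{(x,y):(x-x_1)^2+(1-1/\alpha^2)y^2+(1-\alpha^2)y_1^2=0,\ x\in(k_1,k_2),\ y<0\},$$ $$F^1_3(\bm h_1)=\{\mathbf z=(x,y):\|\mathbf z-\bm n\|_2=\alpha\|\bm h_1-\bm n\|_2,\ x\ge k_2,\ y<0\}.$$ *)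

theory Defs
  imports "HOL-Analysis.Analysis"
begin

type_synonym plane = "real \<times> real"

section \<open>The domain\<close>

definition target_line :: "real \<Rightarrow> plane set" where
  "target_line l = closed_segment (0, 0) (l, 0)"

definition target_region :: "plane set \<Rightarrow> plane set" where
  "target_region \<Omega> = {z \<in> \<Omega>. 0 \<le> snd z}"

definition play_region :: "plane set \<Rightarrow> plane set" where
  "play_region \<Omega> = \<Omega> - target_region \<Omega>"

text \<open>
  \<open>\<Omega>\<close> is closed, since it contains boundary points and its target part is compact. The equation for
  \<open>target_line l\<close> says that the segment cuts \<open>\<Omega>\<close>: the two parts of \<open>\<Omega>\<close> meet in the
  segment and nowhere else.
\<close>

definition game_domain :: "plane set \<Rightarrow> real \<Rightarrow> bool" where
  "game_domain \<Omega> l \<longleftrightarrow>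
     compact \<Omega> \<and> convex \<Omega> \<and> interior \<Omega> \<noteq> {} \<and> 0 < l \<and>
     (0, 0) \<in> frontier \<Omega> \<and> (l, 0) \<in> frontier \<Omega> \<and>
     target_line l = {z \<in> \<Omega>. snd z = 0}"

section \<open>Motions\<close>

definition control :: "(real \<Rightarrow> plane) \<Rightarrow> bool" where
  "control u \<longleftrightarrow> u \<in> borel_measurable lebesgue \<and> (\<forall>t. norm (u t) = 1)"

text \<open>The Caratheodory solution of \<open>z' = v u\<close>, \<open>z(0) = x\<close>, on \<open>t \<ge> 0\<close>.\<close>

definition motion :: "real \<Rightarrow> plane \<Rightarrow> (real \<Rightarrow> plane) \<Rightarrow> real \<Rightarrow> plane" where
  "motion v x u t = x + v *\<^sub>R integral {0..t} u"

definition admissible :: "plane set \<Rightarrow> real \<Rightarrow> plane \<Rightarrow> (real \<Rightarrow> plane) \<Rightarrow> bool" where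
  "admissible A v x u \<longleftrightarrow> control u \<and> (\<forall>t\<ge>0. motion v x u t \<in> A)"

section \<open>Winning regions and barrier\<close>

text \<open>
  The game of a coalition against one evader, for an arbitrary set \<open>A\<close> in which the players move,
  a set \<open>G\<close> that the evader wants to reach, and a set \<open>S\<close> of initial positions of the evader.
  The coalition is indexed by the finite type \<open>'k\<close>, with joint initial position \<open>X\<close>.

  A coincidence of the evader with a pursuer is a capture if the evader has not yet been in \<open>G\<close>. If
  it happens at the very instant at which the evader enters \<open>G\<close>, then capture and arrival are
  simultaneous, and this counts as a win for neither side.

  A strategy of the coalition is a non-anticipative map from evader controls to joint pursuer
  controls: the pursuers' inputs at time \<open>t\<close> may depend on the evader's input up to and including
  time \<open>t\<close>, and hence on the state at time \<open>t\<close>.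
\<close>

definition nonanticipative ::
  "((real \<Rightarrow> plane) \<Rightarrow> bool) \<Rightarrow> ((real \<Rightarrow> plane) \<Rightarrow> 'k \<Rightarrow> real \<Rightarrow> plane) \<Rightarrow> bool" where
  "nonanticipative D \<beta> \<longleftrightarrow>
     (\<forall>u u' t. D u \<and> D u' \<and> (\<forall>s\<in>{0..t}. u s = u' s) \<longrightarrow>
        (\<forall>k. \<forall>s\<in>{0..t}. \<beta> u k s = \<beta> u' k s))"

definition pursuit_winning_region ::
  "plane set \<Rightarrow> plane set \<Rightarrow> plane set \<Rightarrow> real \<Rightarrow> real \<Rightarrow> ('k::finite \<Rightarrow> plane) \<Rightarrow> plane set" where
  "pursuit_winning_region A G S vP vE X =
     {x \<in> S. \<exists>\<beta>. nonanticipative (admissible A vE x) \<beta> \<and>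
        (\<forall>u. admissible A vE x u \<longrightarrow>
           (\<forall>k. admissible A vP (X k) (\<beta> u k)) \<and>
           (\<exists>t\<ge>0. (\<exists>k. motion vP (X k) (\<beta> u k) t = motion vE x u t) \<and>
                  (\<forall>s\<in>{0..t}. motion vE x u s \<notin> G)))}"

text \<open>
  \<open>evader_play A G vE \<gamma> P x u s\<close>: on \<open>[0, s]\<close> the control \<open>u\<close> solves the closed loop of the evader's
  state feedback \<open>\<gamma>\<close> against the joint pursuer motion \<open>P\<close>, and the evader is not in \<open>G\<close> before
  time \<open>s\<close>. The feedback need not be continuous, so that solutions need be neither unique nor
  extendable.
\<close>

definition evader_play ::
  "plane set \<Rightarrow> plane set \<Rightarrow> real \<Rightarrow> (('k \<Rightarrow> plane) \<Rightarrow> plane \<Rightarrow> plane) \<Rightarrow> (real \<Rightarrow> 'k \<Rightarrow> plane) \<Rightarrow>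
   plane \<Rightarrow> (real \<Rightarrow> plane) \<Rightarrow> real \<Rightarrow> bool" where
  "evader_play A G vE \<gamma> P x u s \<longleftrightarrow>
     control u \<and> 0 \<le> s \<and> (\<forall>t\<in>{0..s}. motion vE x u t \<in> A) \<and>
     (\<forall>t\<in>{0..<s}. motion vE x u t \<notin> G \<and> u t = \<gamma> (P t) (motion vE x u t))"

text \<open>
  A feedback guarantees arrival if, whatever the pursuers do, no closed-loop solution meets a pursuer
  up to and including arrival, none gets stuck before arrival, and none goes on forever without
  arriving. (Existence of a solution is the second requirement for \<open>s = 0\<close>.)
\<close>

definition evasion_winning_region ::
  "plane set \<Rightarrow> plane set \<Rightarrow> plane set \<Rightarrow> real \<Rightarrow> real \<Rightarrow> ('k::finite \<Rightarrow> plane) \<Rightarrow> plane set" where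
  "evasion_winning_region A G S vP vE X =
     {x \<in> S. \<exists>\<gamma>. (\<forall>Z z. norm (\<gamma> Z z) = 1) \<and>
        (\<forall>U P. (\<forall>k. admissible A vP (X k) (U k)) \<and> P = (\<lambda>t k. motion vP (X k) (U k) t) \<longrightarrow>
           (\<forall>u s. evader_play A G vE \<gamma> P x u s \<longrightarrow>
              (\<forall>t\<in>{0..s}. \<forall>k. P t k \<noteq> motion vE x u t) \<and>
              (\<exists>u' s'. s \<le> s' \<and> (\<forall>t\<in>{0..<s}. u' t = u t) \<and>
                 evader_play A G vE \<gamma> P x u' s' \<and> motion vE x u' s' \<in> G)) \<and>
           (\<forall>u. \<exists>s\<ge>0. \<not> evader_play A G vE \<gamma> P x u s))}"

definition game_barrier ::
  "plane set \<Rightarrow> plane set \<Rightarrow> plane set \<Rightarrow> real \<Rightarrow> real \<Rightarrow> ('k::finite \<Rightarrow> plane) \<Rightarrow> plane set" where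
  "game_barrier A G S vP vE X =
     S - (pursuit_winning_region A G S vP vE X \<union> evasion_winning_region A G S vP vE X)"

definition barrier ::
  "plane set \<Rightarrow> real \<Rightarrow> real \<Rightarrow> ('k::finite \<Rightarrow> plane) \<Rightarrow> plane set" where
  "barrier \<Omega> vP vE X = game_barrier \<Omega> (target_region \<Omega>) (play_region \<Omega>) vP vE X"

text \<open>
  Without the boundary of the play region the evader can be captured anywhere off the target line,
  also above it.
\<close>

definition free_barrier ::
  "real \<Rightarrow> real \<Rightarrow> real \<Rightarrow> ('k::finite \<Rightarrow> plane) \<Rightarrow> plane set" where
  "free_barrier l vP vE X = game_barrier UNIV (target_line l) {z. snd z < 0} vP vE X"

section \<open>Base curves\<close>

definition k1 :: "real \<Rightarrow> plane \<Rightarrow> real" where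
  "k1 \<alpha> h = \<alpha>\<^sup>2 * fst h"

definition k2 :: "real \<Rightarrow> real \<Rightarrow> plane \<Rightarrow> real" where
  "k2 \<alpha> l h = (1 - \<alpha>\<^sup>2) * l + \<alpha>\<^sup>2 * fst h"

definition base_curve1 :: "real \<Rightarrow> plane \<Rightarrow> plane set" where
  "base_curve1 \<alpha> h =
     {(x, y). norm ((x, y) - (0, 0)) = \<alpha> * norm (h - (0, 0)) \<and> x \<le> k1 \<alpha> h \<and> y < 0}"

definition base_curve2 :: "real \<Rightarrow> real \<Rightarrow> plane \<Rightarrow> plane set" where
  "base_curve2 \<alpha> l h =
     {(x, y). (x - fst h)\<^sup>2 + (1 - 1 / \<alpha>\<^sup>2) * y\<^sup>2 + (1 - \<alpha>\<^sup>2) * (snd h)\<^sup>2 = 0 \<and>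
              x \<in> {k1 \<alpha> h<..<k2 \<alpha> l h} \<and> y < 0}"

definition base_curve3 :: "real \<Rightarrow> real \<Rightarrow> plane \<Rightarrow> plane set" where
  "base_curve3 \<alpha> l h =
     {(x, y). norm ((x, y) - (l, 0)) = \<alpha> * norm (h - (l, 0)) \<and> x \<ge> k2 \<alpha> l h \<and> y < 0}"

end

(*
  For a target point T write d(T) = |T - x| - \<alpha> |T - p|, where p and x are the initial positions of the
  pursuer and the evader. If d is negative somewhere on the target line, the evader runs straight to
  such a point. If d is positive on the whole line, parallel pursuit would intercept the evader inside
  the Apollonius disc of the initial positions, which misses the line. In \<Omega> the pursuer follows the
  projection of a virtual parallel pursuer instead, with an arbitrarily small delay, and closes the
  remaining gap by running straight to the last observed position of the evader over and over. As
  this strategy only samples the evader's position, it works against open-loop controls as well as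
  against discontinuous feedback. If the minimum of d is zero, it is attained at a single point T0:
  an evader running to T0 arrives no later than it can be captured, and a pursuer running to T0
  either meets the evader there or reaches a position with positive d after the evader has deviated.
  On the x-axis |T - x|^2 - \<alpha>^2 |T - p|^2 is a quadratic polynomial, and the base curves list the three
  ways in which its minimum over [0, l] can be zero.
*)

theory Submission imports Defs begin


section \<open>Motions\<close>

text \<open>Controls have norm exactly 1, so no player can wait, and in the domain nobody may leave
  it. Hence the pursuer burns spare path length by a kink, and after a capture it keeps bouncing
  between two points. The endgame has infinitely many legs of finite total duration: the capture
  time is a limit of sampling times, and controls have to be continued beyond that limit.

  The sampled strategy is a causal map from sequences of observations to sequences of waypoints, so
  sampling times and observations determine each other recursively. Against an open-loop control
  this is a fixed-point equation. The closed loop of a feedback may have several solutions; there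
  the play has to be chosen along with the observations.

  Both versions of the game are instances of one locale, in which the barrier is described by
  \<open>S\<close>, \<open>L\<close>, the speeds and the initial positions, while the set
  \<open>A\<close> of allowed positions does not occur. This is why intersecting the free barrier
  with the play region gives the barrier in the domain.\<close>

lemma control_integrable:
  assumes "control u"
  shows "u integrable_on {a..b}"
proof (rule measurable_bounded_by_integrable_imp_integrable[where g = "\<lambda>_. 1"])
  show "u \<in> borel_measurable (lebesgue_on {a..b})"
    using assms by (auto simp: control_def intro: measurable_restrict_space1)
qed (use assms in \<open>auto simp: control_def\<close>)

lemma motion_0 [simp]: "motion v x u 0 = x"
  by (simp add: motion_def)

lemma motion_split:
  assumes "control u" "0 \<le> s" "s \<le> t"
  shows "motion v x u t = motion v x u s + v *\<^sub>R integral {s..t} u"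
  using Henstock_Kurzweil_Integration.integral_combine[OF assms(2,3) control_integrable[OF assms(1)]]
  by (simp add: motion_def algebra_simps flip: scaleR_add_right)

lemma motion_lipschitz:
  assumes u: "control u" and "0 \<le> v" "0 \<le> s" "s \<le> t"
  shows "norm (motion v x u t - motion v x u s) \<le> v * (t - s)"
proof -
  have "norm (integral {s..t} u) \<le> integral {s..t} (\<lambda>_. 1::real)"
    using u by (intro integral_norm_bound_integral control_integrable) (auto simp: control_def)
  then have "norm (integral {s..t} u) \<le> t - s"
    using assms by simp
  then show ?thesis
    using motion_split[OF u assms(3,4), of v x] assms(2) by (simp add: mult_left_mono)
qed

lemma continuous_on_motion:
  assumes "control u" "0 \<le> v"
  shows "continuous_on {0..} (motion v x u)"
proof (rule lipschitz_on_continuous_on)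
  show "v-lipschitz_on {0..} (motion v x u)"
  proof (rule lipschitz_onI)
    fix s t :: real assume st: "s \<in> {0..}" "t \<in> {0..}"
    show "dist (motion v x u s) (motion v x u t) \<le> v * dist s t"
    proof (cases "s \<le> t")
      case True
      with motion_lipschitz[OF assms, of s t x] st show ?thesis
        by (simp add: dist_norm norm_minus_commute)
    next
      case False
      with motion_lipschitz[OF assms, of t s x] st show ?thesis
        by (simp add: dist_norm norm_minus_commute)
    qed
  qed (use assms in auto)
qed

text \<open>The endpoint \<open>t\<close> is a null set for the integral. This matches
  \<open>evader_play\<close>, where the feedback equation is imposed only before the final
  time.\<close>

lemma motion_cong:
  assumes "\<And>r. 0 \<le> r \<Longrightarrow> r < t \<Longrightarrow> u r = w r"
  shows "motion v x u t = motion v x w t"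
proof -
  have "integral {0..t} u = integral {0..t} w"
    by (rule integral_spike[of "{t}"]) (use assms in auto)
  then show ?thesis by (simp add: motion_def)
qed

lemma motion_constant:
  assumes "\<And>r. s \<le> r \<Longrightarrow> r < t \<Longrightarrow> u r = e" and "control u" "0 \<le> s" "s \<le> t"
  shows "motion v x u t = motion v x u s + (v * (t - s)) *\<^sub>R e"
proof -
  have "integral {s..t} u = integral {s..t} (\<lambda>_. e)"
    by (rule integral_spike[of "{t}"]) (use assms in auto)
  then show ?thesis
    using assms motion_split[of u s t v x] by simp
qed

lemma control_constant: "norm e = 1 \<Longrightarrow> control (\<lambda>_. e)"
  by (simp add: control_def)

section \<open>Concatenation of controls\<close>

definition concat_control :: "(real \<Rightarrow> plane) \<Rightarrow> real \<Rightarrow> (real \<Rightarrow> plane) \<Rightarrow> real \<Rightarrow> plane" where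
  "concat_control u s w t = (if t < s then u t else w (t - s))"

lemma control_shift:
  assumes "control w"
  shows "control (\<lambda>t. w (t - s))"
proof -
  have "(\<lambda>t::real. t - s) \<in> lebesgue \<rightarrow>\<^sub>M lebesgue"
    using lebesgue_affine_measurable[of "\<lambda>_. 1" "- s"] by (simp add: Basis_real_def)
  from measurable_compose[OF this] assms show ?thesis
    by (auto simp: control_def)
qed

lemma control_concat:
  assumes "control u" "control w"
  shows "control (concat_control u s w)"
proof -
  have [measurable]: "u \<in> borel_measurable lebesgue" "(\<lambda>t. w (t - s)) \<in> borel_measurable lebesgue"
    using assms control_shift[of w s] by (auto simp: control_def)
  have [measurable]: "{t. t < s} \<in> sets lebesgue"
    using lessThan_borel[of s] by (auto simp: lessThan_def)
  have "concat_control u s w \<in> borel_measurable lebesgue"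
    unfolding concat_control_def by (rule measurable_If) auto
  then show ?thesis
    using assms by (auto simp: control_def concat_control_def)
qed

lemma motion_concat_before: "t \<le> s \<Longrightarrow> motion v x (concat_control u s w) t = motion v x u t"
  by (rule motion_cong) (auto simp: concat_control_def)

lemma motion_concat_after:
  assumes "control u" "control w" "0 \<le> s" "s \<le> t"
  shows "motion v x (concat_control u s w) t = motion v (motion v x u s) w (t - s)"
proof -
  have "integral {s..t} (concat_control u s w) = integral {s..t} (\<lambda>r. w (r - s))"
    by (rule integral_cong) (auto simp: concat_control_def)
  also have "\<dots> = integral {0..t - s} w"
    using integral_shift_real_ivl[of 0 "- s" "t - s" w] by simp
  finally show ?thesis
    using motion_split[OF control_concat[OF assms(1,2)] assms(3,4), of v x s]
    by (simp add: motion_concat_before) (simp add: motion_def)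
qed

section \<open>Polygonal motions\<close>

definition leg_time :: "real \<Rightarrow> (nat \<Rightarrow> plane) \<Rightarrow> nat \<Rightarrow> real" where
  "leg_time v p n = (\<Sum>k<n. norm (p (Suc k) - p k) / v)"

lemma leg_time_0 [simp]: "leg_time v p 0 = 0"
  by (simp add: leg_time_def)

lemma leg_time_Suc: "leg_time v p (Suc n) = leg_time v p n + norm (p (Suc n) - p n) / v"
  by (simp add: leg_time_def)

lemma leg_time_mono: "0 < v \<Longrightarrow> m \<le> n \<Longrightarrow> leg_time v p m \<le> leg_time v p n"
  unfolding leg_time_def by (rule sum_mono2) auto

lemma leg_time_nonneg: "0 < v \<Longrightarrow> 0 \<le> leg_time v p n"
  using leg_time_mono[of v 0 n p] by simp

lemma leg_time_cong: "(\<And>k. k \<le> n \<Longrightarrow> p k = q k) \<Longrightarrow> leg_time v p n = leg_time v q n"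
  unfolding leg_time_def by (rule sum.cong) auto

definition leg_index :: "real \<Rightarrow> (nat \<Rightarrow> plane) \<Rightarrow> real \<Rightarrow> nat" where
  "leg_index v p t = (LEAST n. t < leg_time v p (Suc n))"

text \<open>A leg of length zero has an empty time interval and is skipped, so \<open>sgn\<close> is
  never taken at 0 and the norm stays 1. The control \<open>r\<close> takes over when all legs have
  been run, which happens if their total duration is finite.\<close>

definition waypoint_control ::
  "real \<Rightarrow> (nat \<Rightarrow> plane) \<Rightarrow> (real \<Rightarrow> plane) \<Rightarrow> real \<Rightarrow> plane" where
  "waypoint_control v p r t =
     (if \<exists>n. leg_time v p n \<le> t \<and> t < leg_time v p (Suc n)
      then sgn (p (Suc (leg_index v p t)) - p (leg_index v p t)) else r t)"

lemma waypoint_control_leg: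
  assumes "0 < v" "leg_time v p n \<le> t" "t < leg_time v p (Suc n)"
  shows "waypoint_control v p r t = sgn (p (Suc n) - p n)"
proof -
  have "leg_index v p t = n"
    unfolding leg_index_def
  proof (rule Least_equality)
    fix m assume "t < leg_time v p (Suc m)"
    then have "\<not> Suc m \<le> n"
      using leg_time_mono[OF assms(1), of "Suc m" n p] assms(2) by linarith
    then show "n \<le> m" by simp
  qed (use assms in auto)
  with assms show ?thesis
    by (auto simp: waypoint_control_def)
qed

lemma control_waypoint:
  assumes v: "0 < v" and r: "control r"
  shows "control (waypoint_control v p r)"
proof -
  have [measurable]: "r \<in> borel_measurable lebesgue"
    using r by (simp add: control_def)
  have ivl: "{t. a \<le> t \<and> t < b} \<in> sets lebesgue" for a b :: real
    using atLeastLessThan_borel[of a b] by (auto simp: atLeastLessThan_def atLeast_def lessThan_def Int_def)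
  define E where "E = (\<Union>n. {t. leg_time v p n \<le> t \<and> t < leg_time v p (Suc n)})"
  have E: "E \<in> sets lebesgue"
    unfolding E_def using ivl by blast
  have less: "{t. t < b} \<in> sets lebesgue" for b :: real
    using lessThan_borel[of b] by (auto simp: lessThan_def)
  have idx: "leg_index v p \<in> measurable lebesgue (count_space UNIV)"
    unfolding leg_index_def
    by (rule measurable_Least) (use less in \<open>auto simp: pred_def\<close>)
  have "(\<lambda>t. sgn (p (Suc (leg_index v p t)) - p (leg_index v p t))) \<in> borel_measurable lebesgue"
    by (rule measurable_compose[OF idx]) simp
  moreover have "waypoint_control v p r =
      (\<lambda>t. if t \<in> E then sgn (p (Suc (leg_index v p t)) - p (leg_index v p t)) else r t)"
    by (auto simp: waypoint_control_def E_def)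
  ultimately have "waypoint_control v p r \<in> borel_measurable lebesgue"
    using E by (auto intro!: measurable_If)
  moreover have "norm (waypoint_control v p r t) = 1" for t
  proof (cases "\<exists>n. leg_time v p n \<le> t \<and> t < leg_time v p (Suc n)")
    case True
    then obtain n where n: "leg_time v p n \<le> t" "t < leg_time v p (Suc n)" by blast
    then have "p (Suc n) \<noteq> p n"
      using leg_time_Suc[of v p n] by auto
    with waypoint_control_leg[OF v n] show ?thesis
      by (simp add: norm_sgn)
  next
    case False
    then show ?thesis
      using r by (auto simp: waypoint_control_def control_def)
  qed
  ultimately show ?thesis
    by (simp add: control_def)
qed

lemma motion_waypoint_leg:
  assumes v: "0 < v" and r: "control r" and t: "leg_time v p n \<le> t" "t \<le> leg_time v p (Suc n)"
  shows "motion v (p 0) (waypoint_control v p r) t =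
    p n + (v * (t - leg_time v p n)) *\<^sub>R sgn (p (Suc n) - p n)"
proof -
  let ?m = "motion v (p 0) (waypoint_control v p r)"
  have leg: "?m s = ?m (leg_time v p k) + (v * (s - leg_time v p k)) *\<^sub>R sgn (p (Suc k) - p k)"
    if "leg_time v p k \<le> s" "s \<le> leg_time v p (Suc k)" for k s
    using that leg_time_nonneg[OF v]
    by (intro motion_constant control_waypoint v r) (auto intro: waypoint_control_leg[OF v])
  have "?m (leg_time v p k) = p k" for k
  proof (induction k)
    case (Suc k)
    have "v * (leg_time v p (Suc k) - leg_time v p k) = norm (p (Suc k) - p k)"
      using v by (simp add: leg_time_Suc)
    with Suc leg[of k "leg_time v p (Suc k)"] show ?case
      using leg_time_mono[OF v, of k "Suc k" p]
      by (cases "p (Suc k) = p k") (simp_all add: sgn_div_norm)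
  qed simp
  with leg[OF t] show ?thesis by simp
qed

lemma motion_waypoint:
  assumes "0 < v" "control r"
  shows "motion v (p 0) (waypoint_control v p r) (leg_time v p n) = p n"
  using motion_waypoint_leg[OF assms, of p n "leg_time v p n"]
    leg_time_mono[OF assms(1), of n "Suc n" p] by simp

lemma motion_waypoint_leg_in_segment:
  assumes v: "0 < v" and r: "control r" and t: "leg_time v p n \<le> t" "t \<le> leg_time v p (Suc n)"
  shows "motion v (p 0) (waypoint_control v p r) t \<in> closed_segment (p n) (p (Suc n))"
proof (cases "p (Suc n) = p n")
  case True
  with motion_waypoint_leg[OF assms] show ?thesis by simp
next
  case False
  define d where "d = norm (p (Suc n) - p n)"
  define c where "c = v * (t - leg_time v p n) / d"
  have d: "0 < d" using False by (simp add: d_def)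
  have "leg_time v p (Suc n) = leg_time v p n + d / v"
    by (simp add: leg_time_Suc d_def)
  then have "0 \<le> c" "c \<le> 1"
    using t v d mult_left_mono[OF t(2), of v] by (auto simp: c_def field_simps)
  moreover have "motion v (p 0) (waypoint_control v p r) t = (1 - c) *\<^sub>R p n + c *\<^sub>R p (Suc n)"
    using motion_waypoint_leg[OF assms] d
    by (simp add: c_def sgn_div_norm flip: d_def) (simp add: algebra_simps divide_inverse)
  ultimately show ?thesis
    by (auto simp: in_segment)
qed

text \<open>The second alternative really occurs: in the endgame of the pursuit the leg times
  accumulate at a finite time.\<close>

lemma leg_time_cases:
  assumes v: "0 < v" and t: "0 \<le> t"
  obtains n where "leg_time v p n \<le> t" "t < leg_time v p (Suc n)"
  | "\<And>n. leg_time v p n \<le> t"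
proof (cases "\<exists>n. t < leg_time v p n")
  case True
  define n where "n = (LEAST n. t < leg_time v p n)"
  have n: "t < leg_time v p n"
    unfolding n_def using True by (rule LeastI_ex)
  with t have "n \<noteq> 0" by (auto intro: gr0I)
  then obtain m where m: "n = Suc m" using not0_implies_Suc by blast
  have "\<not> t < leg_time v p m"
    using not_less_Least[of m "\<lambda>n. t < leg_time v p n"] m n_def by simp
  with n m that(1)[of m] show thesis by auto
next
  case False
  with that(2) show thesis by (meson not_less)
qed

text \<open>Unit speed forbids standing still; running back and forth on a segment of
  \<open>A\<close> is the simplest way to stay in \<open>A\<close> forever.\<close>

lemma admissible_bounce:
  assumes A: "convex A" "q \<in> A" "d \<in> A" "q \<noteq> d" and v: "0 < v"
  shows "\<exists>u. admissible A v q u"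
proof -
  define p where "p = (\<lambda>n::nat. if even n then q else d)"
  define r where "r = (\<lambda>_::real. (1, 0) :: plane)"
  have r: "control r"
    unfolding r_def by (rule control_constant) (simp add: norm_prod_def)
  have "leg_time v p n = n * (norm (d - q) / v)" for n
    by (induction n) (auto simp: leg_time_Suc p_def norm_minus_commute algebra_simps add_divide_distrib)
  moreover have "0 < norm (d - q) / v" using A v by simp
  ultimately have unb: "\<exists>n. t < leg_time v p n" for t
    using reals_Archimedean3 by metis
  have p0: "p 0 = q" by (simp add: p_def)
  have "motion v q (waypoint_control v p r) t \<in> A" if "0 \<le> t" for t
  proof (rule leg_time_cases[OF v that, of p])
    fix n assume n: "leg_time v p n \<le> t" "t < leg_time v p (Suc n)"
    have "closed_segment (p n) (p (Suc n)) \<subseteq> A"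
      using A by (intro closed_segment_subset) (auto simp: p_def)
    with motion_waypoint_leg_in_segment[OF v r, of p n t] n show ?thesis
      by (auto simp: p0)
  next
    assume "\<And>n. leg_time v p n \<le> t"
    with unb[of t] show ?thesis by (meson not_less)
  qed
  with control_waypoint[OF v r] show ?thesis
    by (auto simp: admissible_def)
qed

text \<open>The value outside \<open>A\<close> makes this a control for every \<open>q\<close>, so
  that polygonal controls are controls whatever the waypoints are.\<close>

definition default_control :: "plane set \<Rightarrow> real \<Rightarrow> plane \<Rightarrow> real \<Rightarrow> plane" where
  "default_control A v q = (if q \<in> A then (SOME u. admissible A v q u) else (\<lambda>_. (1, 0)))"

text \<open>If a time \<open>t \<ge> 0\<close> lies in no leg, the leg times are bounded by
  \<open>t\<close> and hence converge, and the waypoints converge because the motion is continuous.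
  So both limits exist where they matter.\<close>

definition polygonal_control :: "plane set \<Rightarrow> real \<Rightarrow> (nat \<Rightarrow> plane) \<Rightarrow> real \<Rightarrow> plane" where
  "polygonal_control A v p =
     waypoint_control v p (\<lambda>t. default_control A v (lim p) (t - lim (leg_time v p)))"

text \<open>The two distinct points give every position of \<open>A\<close> a partner at positive
  distance: to bounce against after the last leg, and to make detours towards in the sampled
  pursuit.\<close>

locale arena =
  fixes A :: "plane set" and a1 a2 :: plane
  assumes convex: "convex A" and closed: "closed A" and a: "a1 \<in> A" "a2 \<in> A" "a1 \<noteq> a2"
begin

lemma admissible_default:
  assumes "0 < v" "q \<in> A"
  shows "admissible A v q (default_control A v q)"
proof -
  have "\<exists>u. admissible A v q u"
    using admissible_bounce[of A q a1 v] admissible_bounce[of A q a2 v] assms convex a by blast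
  from someI_ex[OF this] show ?thesis
    using assms by (simp add: default_control_def)
qed

lemma control_default:
  assumes "0 < v"
  shows "control (default_control A v q)"
proof (cases "q \<in> A")
  case True
  with admissible_default[OF assms] show ?thesis
    by (simp add: admissible_def)
qed (simp add: default_control_def control_def norm_prod_def)

lemma control_polygonal: "0 < v \<Longrightarrow> control (polygonal_control A v p)"
  unfolding polygonal_control_def by (intro control_waypoint control_shift control_default)

lemma motion_polygonal:
  "0 < v \<Longrightarrow> motion v (p 0) (polygonal_control A v p) (leg_time v p n) = p n"
  unfolding polygonal_control_def by (intro motion_waypoint control_shift control_default)

lemma polygonal_limit:
  assumes v: "0 < v" and le: "\<And>n. leg_time v p n \<le> T"
  shows "leg_time v p \<longlonglongrightarrow> lim (leg_time v p)"
    and "\<And>n. leg_time v p n \<le> lim (leg_time v p)"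
    and "lim (leg_time v p) \<le> T"
    and "p \<longlonglongrightarrow> motion v (p 0) (polygonal_control A v p) (lim (leg_time v p))"
proof -
  have mono: "incseq (leg_time v p)"
    using leg_time_mono[OF v] by (auto simp: incseq_def)
  obtain L where L: "leg_time v p \<longlonglongrightarrow> L" "\<And>n. leg_time v p n \<le> L"
    using incseq_convergent[OF mono, of T] le by blast
  then show lim: "leg_time v p \<longlonglongrightarrow> lim (leg_time v p)" and le': "\<And>n. leg_time v p n \<le> lim (leg_time v p)"
    by (auto simp: limI)
  show "lim (leg_time v p) \<le> T"
    using lim le by (meson LIMSEQ_le_const2)
  have 0: "0 \<le> lim (leg_time v p)"
    using le'[of 0] by simp
  have "((\<lambda>n. motion v (p 0) (polygonal_control A v p) (leg_time v p n)) \<longlonglongrightarrow>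
      motion v (p 0) (polygonal_control A v p) (lim (leg_time v p)))"
    using v 0 leg_time_nonneg[OF v]
    by (intro continuous_on_tendsto_compose[OF continuous_on_motion lim] control_polygonal) auto
  then show "p \<longlonglongrightarrow> motion v (p 0) (polygonal_control A v p) (lim (leg_time v p))"
    by (simp add: motion_polygonal v)
qed

lemma admissible_polygonal:
  assumes v: "0 < v" and p: "\<And>n. p n \<in> A"
  shows "admissible A v (p 0) (polygonal_control A v p)"
  unfolding admissible_def
proof (intro conjI allI impI control_polygonal v)
  fix t :: real assume t: "0 \<le> t"
  let ?u = "polygonal_control A v p"
  show "motion v (p 0) ?u t \<in> A"
  proof (rule leg_time_cases[OF v t, of p])
    fix n assume n: "leg_time v p n \<le> t" "t < leg_time v p (Suc n)"
    have "closed_segment (p n) (p (Suc n)) \<subseteq> A"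
      using convex p by (intro closed_segment_subset) auto
    moreover have "motion v (p 0) ?u t \<in> closed_segment (p n) (p (Suc n))"
      unfolding polygonal_control_def
      by (rule motion_waypoint_leg_in_segment) (use n v in \<open>auto intro: control_shift control_default\<close>)
    ultimately show ?thesis by blast
  next
    assume le: "\<And>n. leg_time v p n \<le> t"
    define L where "L = lim (leg_time v p)"
    define q where "q = motion v (p 0) ?u L"
    note lim = polygonal_limit[OF v le, folded L_def q_def]
    have q: "q \<in> A"
      using closed_sequentially[OF closed _ lim(4)] p by (simp add: q_def)
    have "lim p = q" using lim(4) by (simp add: q_def limI)
    \<comment> \<open>Every leg ends by time \<open>L\<close>, so from \<open>L\<close> on the
      polygonal control is the shifted default control.\<close>
    then have eq: "?u s = concat_control ?u L (default_control A v q) s" for s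
      using lim(2) by (auto simp: concat_control_def polygonal_control_def waypoint_control_def L_def
        dest: less_le_trans)
    then have eq': "concat_control ?u L (default_control A v q) = ?u" by auto
    have "0 \<le> L" using lim(2)[of 0] by simp
    then have "motion v (p 0) ?u t = motion v q (default_control A v q) (t - L)"
      using motion_concat_after[OF control_polygonal[OF v] control_default[OF v], of L t v "p 0" p q]
        lim(3) by (simp only: q_def[symmetric] eq')
    then show ?thesis
      using admissible_default[OF v q] lim(3) by (auto simp: admissible_def)
  qed
qed

text \<open>Causality in the form that \<open>nonanticipative\<close> asks for: the next waypoint
  has to agree only if the leg towards it has begun by time \<open>t\<close>. If all legs have
  begun, the sequences are equal, and so are the default controls at their limits.\<close>

lemma polygonal_control_cong:
  assumes v: "0 < v" and t: "0 \<le> t"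
    and eq: "\<And>n. leg_time v p n \<le> t \<Longrightarrow> p n = p' n \<Longrightarrow> p (Suc n) = p' (Suc n)" and "p 0 = p' 0"
  shows "polygonal_control A v p t = polygonal_control A v p' t"
proof (rule leg_time_cases[OF v t, of p])
  fix n assume n: "leg_time v p n \<le> t" "t < leg_time v p (Suc n)"
  have same: "k \<le> Suc n \<Longrightarrow> p k = p' k" for k
  proof (induction k)
    case (Suc k)
    then have "leg_time v p k \<le> t"
      using leg_time_mono[OF v, of k n p] n by simp
    with Suc eq show ?case by simp
  qed (simp add: assms)
  then have "leg_time v p n = leg_time v p' n" "leg_time v p (Suc n) = leg_time v p' (Suc n)"
    by (auto intro!: leg_time_cong)
  with n same show ?thesis
    unfolding polygonal_control_def
    by (subst (1 2) waypoint_control_leg[OF v, where n = n]) auto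
next
  assume le: "\<And>n. leg_time v p n \<le> t"
  have "p n = p' n" for n
    by (induction n) (use assms le in auto)
  then have "p = p'" by auto
  then show ?thesis by simp
qed

end


section \<open>The sampled pursuit strategy\<close>

lemma norm_add_scaleR_square:
  fixes s w :: "'a::real_inner"
  assumes "norm w = 1"
  shows "(norm (s + r *\<^sub>R w))\<^sup>2 = (norm s)\<^sup>2 + 2 * r * (s \<bullet> w) + r\<^sup>2"
  using assms unfolding power2_norm_eq_inner
  by (simp add: inner_add_left inner_add_right inner_commute norm_eq_1 power2_eq_square)

text \<open>The larger root \<open>r\<close> of \<open>r^2 + 2 * r * (s \<bullet> w) = c^2\<close>.
  In parallel pursuit along \<open>w\<close> the evader is displaced by \<open>s\<close>, the
  pursuer by \<open>s + r *\<^sub>R w\<close>, and the gap shrinks by \<open>r\<close>. The squared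
  length of the pursuer's step is \<open>(norm s)^2 + c^2\<close>, which is full speed if the evader
  runs at full speed. Against a slower evader the same formula is kept, as it depends on
  \<open>s\<close> through \<open>s \<bullet> w\<close> only.\<close>

definition approach :: "real \<Rightarrow> 'a::real_inner \<Rightarrow> 'a \<Rightarrow> real" where
  "approach c w s = sqrt (c\<^sup>2 + (s \<bullet> w)\<^sup>2) - s \<bullet> w"

lemma approach_nonneg: "0 \<le> approach c w s"
proof -
  have "\<bar>s \<bullet> w\<bar> \<le> sqrt (c\<^sup>2 + (s \<bullet> w)\<^sup>2)"
    using real_sqrt_sum_squares_ge2[of "s \<bullet> w" c] by (intro real_le_rsqrt) simp
  then show ?thesis by (simp add: approach_def)
qed

text \<open>With \<open>x = s \<bullet> w\<close> and \<open>y = sqrt (c^2 + x^2)\<close>, the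
  product of \<open>y - x\<close> and \<open>y + x\<close> is \<open>c^2\<close>, that is
  \<open>(d - e) * (d + e)\<close>, and \<open>y + x\<close> is at most \<open>d + e\<close>. The
  lower bound on \<open>y - x\<close> makes the gap close after finitely many periods.\<close>

lemma approach_bounds:
  fixes s w :: "'a::real_inner"
  assumes w: "norm w = 1" and s: "norm s \<le> e" and "0 \<le> c" and d: "c\<^sup>2 = d\<^sup>2 - e\<^sup>2" and "0 \<le> d"
  shows "d - e \<le> approach c w s" and "approach c w s \<le> d + e"
    and "norm (s + approach c w s *\<^sub>R w) \<le> d"
proof -
  define x where "x = s \<bullet> w"
  define y where "y = sqrt (c\<^sup>2 + x\<^sup>2)"
  have e: "0 \<le> e" using s norm_ge_zero[of s] by linarith
  have x: "\<bar>x\<bar> \<le> e"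
    using Cauchy_Schwarz_ineq2[of s w] w s by (simp add: x_def)
  then have x2: "x\<^sup>2 \<le> e\<^sup>2" using e abs_le_square_iff[of x e] by simp
  have y: "y\<^sup>2 = c\<^sup>2 + x\<^sup>2" "0 \<le> y" by (simp_all add: y_def)
  have "y \<le> d"
    using y x2 d \<open>0 \<le> d\<close> by (intro power2_le_imp_le[of y d]) auto
  then show "approach c w s \<le> d + e"
    using x by (simp add: approach_def flip: x_def y_def)
  have "(d - e) * (d + e) = (y - x) * (y + x)"
    using y d by (simp add: power2_eq_square algebra_simps)
  moreover have "y + x \<le> d + e" "\<bar>x\<bar> \<le> y"
    using \<open>y \<le> d\<close> x y by (auto simp: y_def intro!: real_le_rsqrt)
  ultimately have "d - e \<le> y - x"
  proof -
    have "0 \<le> d - e \<or> d - e \<le> y - x" using \<open>\<bar>x\<bar> \<le> y\<close> by linarith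
    moreover have "d - e \<le> y - x" if "0 \<le> d - e"
    proof (rule ccontr)
      assume "\<not> ?thesis"
      then have lt: "y - x < d - e" by simp
      have "(y - x) * (y + x) \<le> (y - x) * (d + e)"
        using \<open>y + x \<le> d + e\<close> \<open>\<bar>x\<bar> \<le> y\<close> by (intro mult_left_mono) auto
      then have "(d - e) * (d + e) \<le> (y - x) * (d + e)"
        using \<open>(d - e) * (d + e) = (y - x) * (y + x)\<close> by simp
      with lt have "d + e \<le> 0"
        by (meson mult_le_cancel_right not_less)
      with e \<open>0 \<le> d\<close> have "d = 0" "e = 0" by auto
      with lt \<open>\<bar>x\<bar> \<le> y\<close> show False by auto
    qed
    ultimately show ?thesis by blast
  qed
  then show "d - e \<le> approach c w s"
    by (simp add: approach_def flip: x_def y_def)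
  have "(norm (s + (y - x) *\<^sub>R w))\<^sup>2 = (norm s)\<^sup>2 + 2 * (y - x) * x + (y - x)\<^sup>2"
    using norm_add_scaleR_square[OF w] by (simp add: x_def)
  also have "\<dots> = (norm s)\<^sup>2 + c\<^sup>2"
    using y by (simp add: power2_eq_square algebra_simps)
  also have "\<dots> \<le> d\<^sup>2"
    using d s by (simp add: power_mono)
  finally show "norm (s + approach c w s *\<^sub>R w) \<le> d"
    unfolding approach_def x_def[symmetric] y_def[symmetric]
    by (rule power2_le_imp_le[OF _ \<open>0 \<le> d\<close>])
qed

text \<open>
  The discrete form of the fact that the evader stays in the Apollonius disc as long as parallel
  pursuit has not closed the gap \<open>\<rho>\<close>. The integral inequality behind it becomes the triangle
  inequality for the vectors \<open>(c, s\<^sub>k \<bullet> w)\<close>.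
\<close>

lemma apollonius_discrete:
  fixes Z :: "nat \<Rightarrow> 'a::real_inner"
  assumes w: "norm w = 1" and step: "\<And>k. k < n \<Longrightarrow> norm (Z (Suc k) - Z k) \<le> e"
    and c: "c\<^sup>2 = d\<^sup>2 - e\<^sup>2" and "0 \<le> c" "0 \<le> d" "0 \<le> e"
    and gap: "(\<Sum>k<n. approach c w (Z (Suc k) - Z k)) \<le> \<rho>"
  shows "d * norm (Z n - Z 0) \<le> e * norm (Z n - (Z 0 - \<rho> *\<^sub>R w))"
proof -
  define S where "S = Z n - Z 0"
  define x where "x = S \<bullet> w"
  have S: "S = (\<Sum>k<n. Z (Suc k) - Z k)"
    by (simp add: S_def sum_lessThan_telescope)
  have x: "x = (\<Sum>k<n. (Z (Suc k) - Z k) \<bullet> w)"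
    by (simp add: x_def S inner_sum_left)
  have nS: "norm S \<le> n * e"
    using sum_norm_le[of "{..<n}" "\<lambda>k. Z (Suc k) - Z k" "\<lambda>_. e"] step by (simp add: S)
  have "(\<Sum>k<n. (c, (Z (Suc k) - Z k) \<bullet> w)) = (n * c, x)"
    by (simp add: x sum_prod)
  then have "norm (n * c, x) \<le> (\<Sum>k<n. norm (c, (Z (Suc k) - Z k) \<bullet> w))"
    by (metis norm_sum)
  also have "\<dots> = (\<Sum>k<n. approach c w (Z (Suc k) - Z k)) + x"
    by (simp add: norm_prod_def approach_def x sum_subtractf)
  also have "\<dots> \<le> \<rho> + x" using gap by simp
  finally have "(norm (n * c, x))\<^sup>2 \<le> (\<rho> + x)\<^sup>2"
    by (intro power_mono) auto
  then have key: "(n * c)\<^sup>2 + x\<^sup>2 \<le> (\<rho> + x)\<^sup>2"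
    by (simp add: norm_prod_def)
  have "(norm (S + \<rho> *\<^sub>R w))\<^sup>2 = (norm S)\<^sup>2 + 2 * \<rho> * x + \<rho>\<^sup>2"
    using norm_add_scaleR_square[OF w] by (simp add: x_def)
  then have "(norm S)\<^sup>2 + (n * c)\<^sup>2 \<le> (norm (S + \<rho> *\<^sub>R w))\<^sup>2"
    using key by (simp add: power2_eq_square algebra_simps)
  then have "e\<^sup>2 * ((norm S)\<^sup>2 + (n * c)\<^sup>2) \<le> e\<^sup>2 * (norm (S + \<rho> *\<^sub>R w))\<^sup>2"
    by (intro mult_left_mono) auto
  \<comment> \<open>The bound \<open>norm S \<le> n * e\<close> eliminates \<open>n\<close>: it
    replaces \<open>(e * n * c)^2\<close> by \<open>(c * norm S)^2\<close>, and
    \<open>c^2 + e^2 = d^2\<close> does the rest.\<close>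
  moreover have "(norm S)\<^sup>2 \<le> (n * e)\<^sup>2"
    using nS by (intro power_mono) auto
  then have "c\<^sup>2 * (norm S)\<^sup>2 \<le> c\<^sup>2 * (n * e)\<^sup>2"
    by (intro mult_left_mono) auto
  ultimately have "(d * norm S)\<^sup>2 \<le> (e * norm (S + \<rho> *\<^sub>R w))\<^sup>2"
    using c by (simp add: power_mult_distrib algebra_simps)
  then have "d * norm S \<le> e * norm (S + \<rho> *\<^sub>R w)"
    using \<open>0 \<le> e\<close> by (auto intro: power2_le_imp_le)
  then show ?thesis by (simp add: S_def algebra_simps)
qed

definition kink :: "'a::real_normed_vector set \<Rightarrow> real \<Rightarrow> 'a \<Rightarrow> 'a \<Rightarrow> 'a" where
  "kink A L a b = (SOME c. c \<in> A \<and> norm (c - a) + norm (b - c) = L)"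

text \<open>Sliding the corner from \<open>a\<close> to the far point \<open>d\<close> raises the
  length of the detour from \<open>norm (b - a)\<close> to at least \<open>L\<close>. Padding to
  exactly \<open>L\<close> keeps all periods of the pursuit equally long.\<close>

lemma kink:
  assumes A: "convex A" and "a \<in> A" "d \<in> A" "norm (b - a) \<le> L" "L \<le> norm (d - a)"
  shows "kink A L a b \<in> A" "norm (kink A L a b - a) + norm (b - kink A L a b) = L"
proof -
  define f where "f = (\<lambda>t. norm ((a + t *\<^sub>R (d - a)) - a) + norm (b - (a + t *\<^sub>R (d - a))))"
  have "\<exists>t. 0 \<le> t \<and> t \<le> 1 \<and> f t = L"
  proof (rule IVT')
    show "f 0 \<le> L" using assms by (simp add: f_def)
    show "L \<le> f 1" using assms by (simp add: f_def add_increasing2)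
    show "continuous_on {0..1} f" unfolding f_def by (intro continuous_intros)
  qed simp
  then obtain t where t: "0 \<le> t" "t \<le> 1" "f t = L" by blast
  have "a + t *\<^sub>R (d - a) = (1 - t) *\<^sub>R a + t *\<^sub>R d"
    by (simp add: algebra_simps)
  also have "\<dots> \<in> A"
    using assms t by (intro convexD) auto
  finally have "\<exists>c. c \<in> A \<and> norm (c - a) + norm (b - c) = L"
    using t unfolding f_def by blast
  from someI_ex[OF this] show "kink A L a b \<in> A" "norm (kink A L a b - a) + norm (b - kink A L a b) = L"
    by (auto simp: kink_def)
qed

text \<open>
  Every \<open>h\<close> units of time the pursuer looks where parallel pursuit in the whole plane would have
  taken it by now, projects this point to \<open>A\<close>, and takes a path of length \<open>vP h\<close> to the projection.
  When the virtual pursuer has reached the evader, the real one is at distance \<open>O(h)\<close> and from then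
  on runs straight to the last observed position of the evader, again and again.
\<close>

locale chase = arena +
  fixes vP vE h \<rho> :: real and w p0 z0 :: plane
  assumes v: "0 < vE" "vE < vP" and h: "0 < h" "2 * (vP * h) \<le> norm (a2 - a1)"
    and w: "norm w = 1" and \<rho>: "0 \<le> \<rho>" "p0 = z0 - \<rho> *\<^sub>R w" and in_A: "p0 \<in> A" "z0 \<in> A"
begin

text \<open>A period has two legs, so only the observations with even index are \<open>h\<close>
  apart in time; those with odd index are made at the kinks.\<close>

definition gain :: "(nat \<Rightarrow> plane) \<Rightarrow> nat \<Rightarrow> real" where
  "gain z n = (\<Sum>k<n. approach (sqrt (vP\<^sup>2 - vE\<^sup>2) * h) w (z (2 * Suc k) - z (2 * k)))"

definition shadow :: "(nat \<Rightarrow> plane) \<Rightarrow> nat \<Rightarrow> plane" where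
  "shadow z n = closest_point A (z (2 * n) - (\<rho> - gain z n) *\<^sub>R w)"

text \<open>In period \<open>m\<close> the pursuer runs from \<open>shadow z (m - 1)\<close> to
  \<open>shadow z m\<close>, a goal fixed by the observation at the beginning of that period; it
  lags one period behind. For \<open>m = 0\<close> truncated subtraction makes both ends equal to
  \<open>shadow z 0\<close>, which is \<open>p0\<close>.\<close>

primrec waypoint :: "(nat \<Rightarrow> plane) \<Rightarrow> nat \<Rightarrow> plane" where
  "waypoint z 0 = p0"
| "waypoint z (Suc j) =
     (if \<rho> \<le> gain z (j div 2) then z j
      else if even j then kink A (vP * h) (shadow z (j div 2 - 1)) (shadow z (j div 2))
      else shadow z (j div 2))"

lemma vP: "0 < vP" using v by simp

lemma c2: "(sqrt (vP\<^sup>2 - vE\<^sup>2) * h)\<^sup>2 = (vP * h)\<^sup>2 - (vE * h)\<^sup>2"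
proof -
  have "vE\<^sup>2 \<le> vP\<^sup>2" using v by (simp add: power_mono)
  then show ?thesis by (simp add: power_mult_distrib algebra_simps)
qed

lemma c_nonneg: "0 \<le> sqrt (vP\<^sup>2 - vE\<^sup>2) * h"
proof -
  have "vE\<^sup>2 \<le> vP\<^sup>2" using v by (simp add: power_mono)
  then show ?thesis using h by simp
qed

lemma gain_cong: "(\<And>k. k \<le> 2 * n \<Longrightarrow> z k = z' k) \<Longrightarrow> gain z n = gain z' n"
  unfolding gain_def by (rule sum.cong) auto

lemma gain_mono: "m \<le> n \<Longrightarrow> gain z m \<le> gain z n"
  unfolding gain_def by (rule sum_mono2) (auto intro: approach_nonneg)

lemma shadow_cong: "(\<And>k. k \<le> 2 * n \<Longrightarrow> z k = z' k) \<Longrightarrow> shadow z n = shadow z' n"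
  unfolding shadow_def using gain_cong[of n z z'] by auto

lemma waypoint_cong:
  assumes "\<And>k. k < n \<Longrightarrow> z k = z' k"
  shows "waypoint z n = waypoint z' n"
proof (cases n)
  case (Suc j)
  then have eq: "\<And>k. k \<le> j \<Longrightarrow> z k = z' k" using assms by auto
  then have "gain z (j div 2) = gain z' (j div 2)"
    "shadow z (j div 2) = shadow z' (j div 2)" "shadow z (j div 2 - 1) = shadow z' (j div 2 - 1)"
    by (auto intro!: gain_cong shadow_cong)
  with eq show ?thesis by (simp add: Suc)
qed simp

lemma shadow_in_A: "shadow z n \<in> A"
  unfolding shadow_def using closed a by (intro closest_point_in_set) auto

definition sampled :: "(nat \<Rightarrow> plane) \<Rightarrow> bool" where
  "sampled z \<longleftrightarrow> z 0 = z0 \<and> (\<forall>n. z n \<in> A) \<and>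
     (\<forall>n. norm (z (Suc n) - z n) \<le>
        vE * (leg_time vP (waypoint z) (Suc n) - leg_time vP (waypoint z) n))"

lemma sampled_diff:
  assumes "sampled z" "m \<le> n"
  shows "norm (z n - z m) \<le> vE * (leg_time vP (waypoint z) n - leg_time vP (waypoint z) m)"
  using assms(2)
proof (induction n rule: dec_induct)
  case (step n)
  have "norm (z (Suc n) - z m) \<le> norm (z (Suc n) - z n) + norm (z n - z m)"
    by norm
  moreover have "norm (z (Suc n) - z n) \<le>
      vE * (leg_time vP (waypoint z) (Suc n) - leg_time vP (waypoint z) n)"
    using assms(1) by (simp add: sampled_def)
  ultimately show ?case
    using step.IH by (simp only: right_diff_distrib)
qed simp

lemma far_point: "q \<in> A \<Longrightarrow> \<exists>d\<in>A. vP * h \<le> norm (d - q)"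
proof -
  have "norm (a2 - a1) \<le> norm (a2 - q) + norm (a1 - q)" by norm
  with h have "vP * h \<le> norm (a2 - q) \<or> vP * h \<le> norm (a1 - q)" by linarith
  with a show ?thesis by blast
qed

lemma shadow_0: "z 0 = z0 \<Longrightarrow> shadow z 0 = p0"
  using in_A \<rho> by (simp add: shadow_def gain_def closest_point_self)

text \<open>Projection to a closed convex set does not increase distances, so the shadow inherits
  the speed bound of the virtual pursuer.\<close>

lemma shadow_step:
  assumes "norm (z (2 * Suc n) - z (2 * n)) \<le> vE * h"
  shows "norm (shadow z (Suc n) - shadow z n) \<le> vP * h"
proof -
  let ?s = "z (2 * Suc n) - z (2 * n)"
  have "dist (shadow z (Suc n)) (shadow z n) \<le>
      dist (z (2 * Suc n) - (\<rho> - gain z (Suc n)) *\<^sub>R w) (z (2 * n) - (\<rho> - gain z n) *\<^sub>R w)"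
    unfolding shadow_def using convex closed a by (intro closest_point_lipschitz) auto
  also have "\<dots> = norm (?s + (gain z (Suc n) - gain z n) *\<^sub>R w)"
    by (simp add: dist_norm algebra_simps)
  also have "gain z (Suc n) - gain z n = approach (sqrt (vP\<^sup>2 - vE\<^sup>2) * h) w ?s"
    by (simp add: gain_def)
  also have "norm (?s + \<dots> *\<^sub>R w) \<le> vP * h"
    using approach_bounds(3)[OF w assms c_nonneg c2] v h by simp
  finally show ?thesis by (simp add: dist_norm)
qed

text \<open>Clock, position and displacement bound need a joint induction: the bound on the previous
  displacement makes the next shadow reachable within a period, and the length of the period bounds
  the next displacement.\<close>

lemma aligned:
  assumes z: "sampled z"
  shows "(\<And>k. k < n \<Longrightarrow> gain z k < \<rho>) \<Longrightarrow>
    leg_time vP (waypoint z) (2 * n) = n * h \<and> waypoint z (2 * n) = shadow z (n - 1) \<and>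
    (\<forall>k<n. norm (z (2 * Suc k) - z (2 * k)) \<le> vE * h)"
    and "(\<And>k. k \<le> n \<Longrightarrow> gain z k < \<rho>) \<Longrightarrow>
      waypoint z (Suc (2 * n)) \<in> A \<and>
      leg_time vP (waypoint z) (2 * Suc n) = leg_time vP (waypoint z) (2 * n) + h"
proof -
  have z_0: "z 0 = z0" using z by (simp add: sampled_def)
  have leg: "waypoint z (Suc (2 * n)) \<in> A \<and>
      leg_time vP (waypoint z) (2 * Suc n) = leg_time vP (waypoint z) (2 * n) + h"
    if less: "gain z n < \<rho>" and pos: "waypoint z (2 * n) = shadow z (n - 1)"
      and steps: "\<forall>k<n. norm (z (2 * Suc k) - z (2 * k)) \<le> vE * h" for n
  proof -
    let ?c = "kink A (vP * h) (shadow z (n - 1)) (shadow z n)"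
    have "norm (shadow z n - shadow z (n - 1)) \<le> vP * h"
      using shadow_step[of z "n - 1"] steps v h by (cases n) auto
    moreover obtain d where "d \<in> A" "vP * h \<le> norm (d - shadow z (n - 1))"
      using far_point[OF shadow_in_A] by blast
    ultimately have c: "?c \<in> A" "norm (?c - shadow z (n - 1)) + norm (shadow z n - ?c) = vP * h"
      using kink[OF convex shadow_in_A] by blast+
    have 1: "waypoint z (Suc (2 * n)) = ?c" and 2: "waypoint z (Suc (Suc (2 * n))) = shadow z n"
      using less by auto
    have "leg_time vP (waypoint z) (2 * Suc n) = leg_time vP (waypoint z) (2 * n)
        + (norm (?c - shadow z (n - 1)) + norm (shadow z n - ?c)) / vP"
      by (simp add: leg_time_Suc 1 2 pos add_divide_distrib del: waypoint.simps(2))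
    with c 1 vP show ?thesis by simp
  qed
  have main: "leg_time vP (waypoint z) (2 * n) = n * h \<and> waypoint z (2 * n) = shadow z (n - 1) \<and>
    (\<forall>k<n. norm (z (2 * Suc k) - z (2 * k)) \<le> vE * h)" if "\<And>k. k < n \<Longrightarrow> gain z k < \<rho>" for n
    using that
  proof (induction n)
    case 0
    show ?case using shadow_0[of z] z_0 by simp
  next
    case (Suc n)
    then have IH: "leg_time vP (waypoint z) (2 * n) = n * h" "waypoint z (2 * n) = shadow z (n - 1)"
      "\<forall>k<n. norm (z (2 * Suc k) - z (2 * k)) \<le> vE * h" by auto
    note L = leg[OF Suc.prems[OF lessI] IH(2,3)]
    have "norm (z (2 * Suc n) - z (2 * n)) \<le> vE * h"
      using sampled_diff[OF z, of "2 * n" "2 * Suc n"] L by simp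
    moreover have "waypoint z (2 * Suc n) = shadow z n"
      using Suc.prems[OF lessI] by simp
    ultimately show ?case
      using IH L by (auto simp: less_Suc_eq algebra_simps)
  qed
  then show "(\<And>k. k < n \<Longrightarrow> gain z k < \<rho>) \<Longrightarrow>
    leg_time vP (waypoint z) (2 * n) = n * h \<and> waypoint z (2 * n) = shadow z (n - 1) \<and>
    (\<forall>k<n. norm (z (2 * Suc k) - z (2 * k)) \<le> vE * h)" .
  show "(\<And>k. k \<le> n \<Longrightarrow> gain z k < \<rho>) \<Longrightarrow>
      waypoint z (Suc (2 * n)) \<in> A \<and>
      leg_time vP (waypoint z) (2 * Suc n) = leg_time vP (waypoint z) (2 * n) + h"
    using leg[of n] main[of n] by simp
qed

lemma waypoint_in_A:
  assumes z: "sampled z"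
  shows "waypoint z n \<in> A"
proof (cases n)
  case (Suc j)
  have "kink A (vP * h) (shadow z (j div 2 - 1)) (shadow z (j div 2)) \<in> A"
    if "gain z (j div 2) < \<rho>" "even j"
  proof -
    have "waypoint z (Suc (2 * (j div 2))) \<in> A"
    proof -
      have "gain z k < \<rho>" if "k \<le> j div 2" for k
        using gain_mono[OF that, of z] \<open>gain z (j div 2) < \<rho>\<close> by simp
      with aligned(2)[OF z, of "j div 2"] show ?thesis by blast
    qed
    with that show ?thesis by simp
  qed
  with Suc shadow_in_A z show ?thesis
    by (auto simp: sampled_def not_le)
qed (simp add: in_A)

lemma ex_caught_up:
  assumes z: "sampled z"
  obtains N where "\<rho> \<le> gain z N" "\<And>k. k < N \<Longrightarrow> gain z k < \<rho>"
proof -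
  have "\<exists>n. \<rho> \<le> gain z n"
  proof (rule ccontr)
    assume "\<not> ?thesis"
    then have less: "gain z k < \<rho>" for k by (meson not_less)
    have "n * ((vP - vE) * h) \<le> gain z n" for n
    proof -
      have "norm (z (2 * Suc k) - z (2 * k)) \<le> vE * h" for k
        using aligned(1)[OF z, of "Suc k"] less by blast
      then have "vP * h - vE * h \<le> approach (sqrt (vP\<^sup>2 - vE\<^sup>2) * h) w (z (2 * Suc k) - z (2 * k))" for k
        using approach_bounds(1)[OF w _ c_nonneg c2] v h by simp
      then have "(\<Sum>k<n. vP * h - vE * h) \<le> gain z n"
        unfolding gain_def by (rule sum_mono)
      then show ?thesis by (simp add: algebra_simps)
    qed
    moreover obtain n where "\<rho> < real n * ((vP - vE) * h)"
      using reals_Archimedean3[of "(vP - vE) * h"] v h by auto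
    ultimately show False using less[of n] by (meson le_less_trans less_asym not_le)
  qed
  then have "\<rho> \<le> gain z (LEAST n. \<rho> \<le> gain z n)" by (rule LeastI_ex)
  moreover have "gain z k < \<rho>" if "k < (LEAST n. \<rho> \<le> gain z n)" for k
    using not_less_Least[OF that] by simp
  ultimately show thesis using that by blast
qed

text \<open>Running to the last observed position at distance \<open>g\<close> takes time
  \<open>g / vP\<close>, in which the evader gets at most \<open>vE / vP * g\<close> away from it.
  So the distance contracts geometrically, and elapsed time plus distance over
  \<open>vP - vE\<close> never increases.\<close>

lemma endgame:
  assumes z: "sampled z" and N: "\<rho> \<le> gain z N"
  defines "gap \<equiv> norm (z (2 * N) - waypoint z (2 * N))"
  assumes j: "2 * N \<le> j"
  shows "leg_time vP (waypoint z) j \<le> leg_time vP (waypoint z) (2 * N) + gap / (vP - vE)"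
    and "norm (z j - waypoint z j) \<le> (vE / vP) ^ (j - 2 * N) * gap"
proof -
  let ?t = "leg_time vP (waypoint z)"
  define g where "g j = norm (z j - waypoint z j)" for j
  have "?t j + g j / (vP - vE) \<le> ?t (2 * N) + gap / (vP - vE) \<and> g j \<le> (vE / vP) ^ (j - 2 * N) * gap"
    using j
  proof (induction j rule: dec_induct)
    case base
    show ?case by (simp add: g_def gap_def)
  next
    case (step j)
    have "N \<le> j div 2" using step.hyps by simp
    with N gain_mono[of N "j div 2" z] have wp: "waypoint z (Suc j) = z j" by simp
    then have t: "?t (Suc j) = ?t j + g j / vP"
      by (simp add: leg_time_Suc g_def)
    have "g (Suc j) \<le> vE * (?t (Suc j) - ?t j)"
      using z wp by (simp add: sampled_def g_def)
    then have gS: "g (Suc j) \<le> vE / vP * g j"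
      using t by simp
    have "?t (Suc j) + g (Suc j) / (vP - vE) \<le> ?t j + g j / vP + (vE / vP * g j) / (vP - vE)"
      using divide_right_mono[OF gS, of "vP - vE"] v t by simp
    also have "\<dots> = ?t j + g j / (vP - vE)"
      using v by (simp add: field_simps)
    finally have "?t (Suc j) + g (Suc j) / (vP - vE) \<le> ?t (2 * N) + gap / (vP - vE)"
      using step.IH by simp
    moreover have "vE / vP * g j \<le> vE / vP * ((vE / vP) ^ (j - 2 * N) * gap)"
      using step.IH v by (intro mult_left_mono) auto
    with gS have "g (Suc j) \<le> (vE / vP) ^ (Suc j - 2 * N) * gap"
      using step.hyps by (simp add: Suc_diff_le mult.assoc)
    ultimately show ?case by simp
  qed
  moreover have "0 \<le> g j / (vP - vE)"
    using v by (simp add: g_def)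
  ultimately show "?t j \<le> ?t (2 * N) + gap / (vP - vE)"
    and "norm (z j - waypoint z j) \<le> (vE / vP) ^ (j - 2 * N) * gap"
    by (auto simp: g_def)
qed

text \<open>The overshoot is at most the last gain, \<open>vP * h + vE * h\<close>, and contributes
  two of the three units; the lag of one period contributes the third.\<close>

lemma caught_up_gap:
  assumes z: "sampled z" and N: "\<rho> \<le> gain z N" "\<And>k. k < N \<Longrightarrow> gain z k < \<rho>"
  shows "norm (z (2 * N) - waypoint z (2 * N)) \<le> 3 * (vP * h)"
proof (cases N)
  case 0
  then have "\<rho> = 0" using N(1) \<rho> by (simp add: gain_def)
  then have "z0 = p0" using \<rho> by simp
  then have "waypoint z 0 = z 0" using z unfolding sampled_def waypoint.simps(1) by blast
  from this[symmetric] have "norm (z (2 * N) - waypoint z (2 * N)) = 0"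
    unfolding 0 mult_0_right by (simp only: norm_eq_zero right_minus_eq)
  moreover have "0 < vP * h" using h vP by simp
  ultimately show ?thesis by linarith
next
  case (Suc m)
  have al: "waypoint z (2 * N) = shadow z m" "norm (z (2 * Suc m) - z (2 * m)) \<le> vE * h"
    using aligned(1)[OF z, of N, OF N(2)] Suc by (auto simp del: waypoint.simps)
  have "z (2 * N) = closest_point A (z (2 * N))"
    using z by (simp add: closest_point_self sampled_def)
  then have "norm (z (2 * N) - shadow z N) \<le> dist (z (2 * N)) (z (2 * N) - (\<rho> - gain z N) *\<^sub>R w)"
    using closest_point_lipschitz[OF convex closed, of "z (2 * N)" "z (2 * N) - (\<rho> - gain z N) *\<^sub>R w"] a
    by (auto simp: shadow_def dist_norm)
  also have "\<dots> = gain z N - \<rho>"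
    using w N by (simp add: dist_norm)
  also have "\<dots> \<le> gain z N - gain z m"
    using N(2)[of m] Suc by simp
  also have "\<dots> \<le> vP * h + vE * h"
    using approach_bounds(2)[OF w al(2) c_nonneg c2] v h by (simp add: gain_def Suc)
  finally have "norm (z (2 * N) - shadow z N) \<le> 2 * (vP * h)"
    using v h mult_right_mono[of vE vP h] by linarith
  moreover have "norm (shadow z N - shadow z m) \<le> vP * h"
    using shadow_step[OF al(2)] Suc by simp
  moreover have "norm (z (2 * N) - shadow z m) \<le> norm (z (2 * N) - shadow z N) + norm (shadow z N - shadow z m)"
    by norm
  ultimately show ?thesis using al by simp
qed

text \<open>The alternative \<open>k = 0\<close> covers \<open>N = 0\<close>, that is, a start
  without any gap.\<close>

lemma apollonius_until_caught_up:
  assumes z: "sampled z" and N: "\<And>k. k < N \<Longrightarrow> gain z k < \<rho>" and k: "k < N \<or> k = 0"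
  shows "vP * norm (z (2 * k) - z0) \<le> vE * norm (z (2 * k) - p0)"
proof -
  have z_0: "z 0 = z0" using z by (simp add: sampled_def)
  have "gain z k \<le> \<rho>" using k N[of k] \<rho> by (auto simp: gain_def)
  moreover have "norm (z (2 * Suc i) - z (2 * i)) \<le> vE * h" if "i < k" for i
    using aligned(1)[OF z, of N, OF N] k that by auto
  ultimately have "vP * h * norm (z (2 * k) - z (2 * 0)) \<le> vE * h * norm (z (2 * k) - (z (2 * 0) - \<rho> *\<^sub>R w))"
    using v h unfolding gain_def
    by (intro apollonius_discrete[where Z = "\<lambda>k. z (2 * k)", OF w _ c2 c_nonneg]) auto
  then have "h * (vP * norm (z (2 * k) - z0)) \<le> h * (vE * norm (z (2 * k) - p0))"
    using z_0 by (simp add: mult.assoc mult.left_commute flip: \<rho>(2))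
  then show ?thesis using h by simp
qed

text \<open>In the third claim \<open>y\<close> is the evader's position at the start of the current
  period or, in the endgame, of the last period before the gap was closed. The endgame closes a
  distance of at most \<open>3 * (vP * h)\<close> at relative speed \<open>vP - vE\<close>, hence
  the second term of the constant. The way that the evader can go during the next leg is included,
  so the estimate also holds between observations.\<close>

lemma chase:
  assumes z: "sampled z"
  shows "\<exists>B. \<forall>n. leg_time vP (waypoint z) n \<le> B"
    and "(\<lambda>n. waypoint z n - z n) \<longlonglongrightarrow> 0"
    and "\<exists>y. vP * norm (y - z0) \<le> vE * norm (y - p0) \<and>
      norm (y - z n) + vE * (leg_time vP (waypoint z) (Suc n) - leg_time vP (waypoint z) n)
        \<le> (2 * vE + 3 * vP * vE / (vP - vE)) * h"
proof -
  let ?t = "leg_time vP (waypoint z)"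
  obtain N where N: "\<rho> \<le> gain z N" "\<And>k. k < N \<Longrightarrow> gain z k < \<rho>"
    using ex_caught_up[OF z] by blast
  define gap where "gap = norm (z (2 * N) - waypoint z (2 * N))"
  have gap: "gap \<le> 3 * (vP * h)"
    unfolding gap_def by (rule caught_up_gap[OF z N])
  note E = endgame[OF z N(1), folded gap_def]
  have "?t n \<le> ?t (2 * N) + gap / (vP - vE)" for n
    using E(1)[of "max n (2 * N)"] leg_time_mono[OF vP, of n "max n (2 * N)" "waypoint z"] by simp
  then show "\<exists>B. \<forall>n. ?t n \<le> B" by blast
  have "(\<lambda>i. (vE / vP) ^ i * gap) \<longlonglongrightarrow> 0"
    using v by (intro tendsto_mult_left_zero LIMSEQ_power_zero) simp
  moreover have "norm (waypoint z (i + 2 * N) - z (i + 2 * N)) \<le> (vE / vP) ^ i * gap" for i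
    using E(2)[of "i + 2 * N"] by (simp add: norm_minus_commute)
  then have "\<forall>\<^sub>F i in sequentially.
      norm (waypoint z (i + 2 * N) - z (i + 2 * N)) \<le> (vE / vP) ^ i * gap"
    by (intro always_eventually allI)
  ultimately have "(\<lambda>i. waypoint z (i + 2 * N) - z (i + 2 * N)) \<longlonglongrightarrow> 0"
    by (rule Lim_null_comparison[rotated])
  then show "(\<lambda>n. waypoint z n - z n) \<longlonglongrightarrow> 0"
    by (rule LIMSEQ_offset)
  define K where "K = 3 * vP * vE / (vP - vE)"
  have K: "0 \<le> K" using v by (simp add: K_def)
  show "\<exists>y. vP * norm (y - z0) \<le> vE * norm (y - p0) \<and>
      norm (y - z n) + vE * (?t (Suc n) - ?t n) \<le> (2 * vE + K) * h"
  proof (cases "n < 2 * N")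
    case True
    define k where "k = n div 2"
    have k: "k < N" "2 * k \<le> n" "Suc n \<le> 2 * Suc k" using True by (auto simp: k_def)
    have tk: "?t (2 * Suc k) = ?t (2 * k) + h"
      using aligned(2)[OF z, of k] N(2) k by simp
    have "norm (z n - z (2 * k)) \<le> vE * (?t n - ?t (2 * k))"
      using sampled_diff[OF z k(2)] .
    then have "norm (z (2 * k) - z n) + vE * (?t (Suc n) - ?t n) \<le> vE * (?t (Suc n) - ?t (2 * k))"
      by (simp add: norm_minus_commute algebra_simps)
    also have "\<dots> \<le> vE * h"
      using leg_time_mono[OF vP k(3), of "waypoint z"] tk v by (intro mult_left_mono) auto
    also have "\<dots> \<le> (2 * vE + K) * h"
      using v h K by (intro mult_right_mono) auto
    finally show ?thesis
      using apollonius_until_caught_up[OF z N(2), of N k] k by blast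
  next
    case False
    define k where "k = N - 1"
    have "norm (z (2 * N) - z (2 * k)) \<le> vE * h"
      using aligned(1)[OF z, of N, OF N(2)] v h by (cases N) (auto simp: k_def)
    moreover have "norm (z n - z (2 * N)) \<le> vE * (?t n - ?t (2 * N))"
      using sampled_diff[OF z, of "2 * N" n] False by simp
    moreover have "norm (z (2 * k) - z n) \<le> norm (z (2 * N) - z (2 * k)) + norm (z n - z (2 * N))"
      by norm
    ultimately have "norm (z (2 * k) - z n) + vE * (?t (Suc n) - ?t n) \<le> vE * h + vE * (?t (Suc n) - ?t (2 * N))"
      by (simp add: algebra_simps)
    also have "\<dots> \<le> vE * h + vE * (3 * (vP * h) / (vP - vE))"
    proof -
      have "?t (Suc n) - ?t (2 * N) \<le> gap / (vP - vE)"
        using E(1)[of "Suc n"] False by simp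
      also have "\<dots> \<le> 3 * (vP * h) / (vP - vE)"
        using gap v by (intro divide_right_mono) auto
      finally show ?thesis using v by (intro add_left_mono mult_left_mono) auto
    qed
    also have "\<dots> \<le> (2 * vE + K) * h"
      using v h by (simp add: K_def algebra_simps)
    finally show ?thesis
      using apollonius_until_caught_up[OF z N(2), of N k] by (cases N) (auto simp: k_def simp del: split_paired_Ex)
  qed
qed

end

section \<open>Guarding a compact set by a sampled strategy\<close>

context arena
begin

text \<open>All that the outcome of the game has to know about the pursuit. The last clause
  subtracts what the evader can run before the next observation; hence it stays at distance
  \<open>\<epsilon>\<close> from \<open>L\<close> at all times, not only at the observed
  ones.\<close>

definition guarding_strategy ::
  "plane set \<Rightarrow> real \<Rightarrow> real \<Rightarrow> plane \<Rightarrow> plane \<Rightarrow> ((nat \<Rightarrow> plane) \<Rightarrow> nat \<Rightarrow> plane) \<Rightarrow> real \<Rightarrow> bool" where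
  "guarding_strategy L vP vE p0 z0 \<sigma> \<epsilon> \<longleftrightarrow> 0 < \<epsilon> \<and> (\<forall>z. \<sigma> z 0 = p0) \<and>
     (\<forall>z z' n. (\<forall>k<n. z k = z' k) \<longrightarrow> \<sigma> z n = \<sigma> z' n) \<and>
     (\<forall>z. z 0 = z0 \<and> (\<forall>n. z n \<in> A) \<and>
        (\<forall>n. norm (z (Suc n) - z n) \<le> vE * (leg_time vP (\<sigma> z) (Suc n) - leg_time vP (\<sigma> z) n)) \<longrightarrow>
        (\<forall>n. \<sigma> z n \<in> A) \<and> (\<exists>B. \<forall>n. leg_time vP (\<sigma> z) n \<le> B) \<and> (\<lambda>n. \<sigma> z n - z n) \<longlonglongrightarrow> 0 \<and>
        (\<forall>n. \<forall>T\<in>L. \<epsilon> + vE * (leg_time vP (\<sigma> z) (Suc n) - leg_time vP (\<sigma> z) n) \<le> norm (T - z n)))"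

lemma guarding_strategyD:
  assumes "guarding_strategy L vP vE p0 z0 \<sigma> \<epsilon>"
  shows "0 < \<epsilon>" and "\<sigma> z 0 = p0"
    and "(\<And>k. k < n \<Longrightarrow> z k = z' k) \<Longrightarrow> \<sigma> z n = \<sigma> z' n"
    and "(\<And>k. k < n \<Longrightarrow> z k = z' k) \<Longrightarrow> leg_time vP (\<sigma> z) n = leg_time vP (\<sigma> z') n"
proof -
  show causal: "(\<And>k. k < n \<Longrightarrow> z k = z' k) \<Longrightarrow> \<sigma> z n = \<sigma> z' n" for n
    using assms unfolding guarding_strategy_def by blast
  show "(\<And>k. k < n \<Longrightarrow> z k = z' k) \<Longrightarrow> leg_time vP (\<sigma> z) n = leg_time vP (\<sigma> z') n"
    by (intro leg_time_cong causal) auto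
qed (use assms in \<open>auto simp: guarding_strategy_def\<close>)

lemma guarding_strategy_play:
  assumes "guarding_strategy L vP vE p0 z0 \<sigma> \<epsilon>" and "z 0 = z0" and "\<And>n. z n \<in> A"
    and "\<And>n. norm (z (Suc n) - z n) \<le> vE * (leg_time vP (\<sigma> z) (Suc n) - leg_time vP (\<sigma> z) n)"
  shows "\<sigma> z n \<in> A" and "\<exists>B. \<forall>n. leg_time vP (\<sigma> z) n \<le> B" and "(\<lambda>n. \<sigma> z n - z n) \<longlonglongrightarrow> 0"
    and "T \<in> L \<Longrightarrow> \<epsilon> + vE * (leg_time vP (\<sigma> z) (Suc n) - leg_time vP (\<sigma> z) n) \<le> norm (T - z n)"
  using assms unfolding guarding_strategy_def by blast+

lemma ex_guarding_strategy:
  assumes v: "0 < vE" "vE < vP" and in_A: "p0 \<in> A" "z0 \<in> A" and L: "compact L"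
    and sep: "\<And>T. T \<in> L \<Longrightarrow> vE * norm (T - p0) < vP * norm (T - z0)"
  shows "\<exists>\<sigma> \<epsilon>. guarding_strategy L vP vE p0 z0 \<sigma> \<epsilon>"
proof -
  define D where "D = {y. vP * norm (y - z0) \<le> vE * norm (y - p0)}"
  have "closed D"
    unfolding D_def by (intro closed_Collect_le continuous_intros)
  moreover have "L \<inter> D = {}"
    using sep by (fastforce simp: D_def)
  ultimately obtain \<delta> where \<delta>: "0 < \<delta>" "\<And>T y. T \<in> L \<Longrightarrow> y \<in> D \<Longrightarrow> \<delta> \<le> dist T y"
    using separate_compact_closed[OF L, of D] by blast
  define C where "C = 2 * vE + 3 * vP * vE / (vP - vE)"
  have C: "0 < C"
    unfolding C_def using v by (intro add_pos_nonneg) auto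
  \<comment> \<open>Half of the separation \<open>\<delta>\<close> pays for the sampling error
    \<open>C * h\<close>, the other half is the margin of the strategy. The second bound guarantees
    a far point for the kinks.\<close>
  define h where "h = min (\<delta> / (2 * C)) (norm (a2 - a1) / (2 * vP))"
  have h_bounds: "0 < h" "C * h \<le> \<delta> / 2" "2 * (vP * h) \<le> norm (a2 - a1)"
  proof -
    show "0 < h" using \<delta> C v a by (simp add: h_def)
    have "h \<le> \<delta> / (2 * C)" "h \<le> norm (a2 - a1) / (2 * vP)" by (auto simp: h_def)
    then show "C * h \<le> \<delta> / 2" "2 * (vP * h) \<le> norm (a2 - a1)"
      using C v by (auto simp: field_simps)
  qed
  define \<rho> where "\<rho> = norm (z0 - p0)"
  \<comment> \<open>If both players start at the same point, the gap is 0 and any unit vector serves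
    as direction.\<close>
  define w where "w = (if z0 = p0 then (1, 0) else sgn (z0 - p0))"
  have w: "norm w = 1"
    by (cases "z0 = p0") (simp add: w_def norm_prod_def, simp add: w_def norm_sgn)
  have gap: "p0 = z0 - \<rho> *\<^sub>R w"
    unfolding w_def \<rho>_def by (cases "z0 = p0") (simp_all add: sgn_div_norm del: scaleR_Pair)
  interpret chase A a1 a2 vP vE h \<rho> w p0 z0
    by unfold_locales (use v h_bounds w gap in_A in \<open>auto simp: \<rho>_def\<close>)
  have "guarding_strategy L vP vE p0 z0 waypoint (\<delta> / 2)"
    unfolding guarding_strategy_def
  proof (intro conjI allI impI)
    show "0 < \<delta> / 2" using \<delta> by simp
    show "waypoint z 0 = p0" for z by simp
    show "waypoint z n = waypoint z' n" if "\<forall>k<n. z k = z' k" for z z' n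
      using waypoint_cong that by blast
  next
    fix z assume "z 0 = z0 \<and> (\<forall>n. z n \<in> A) \<and> (\<forall>n. norm (z (Suc n) - z n) \<le>
      vE * (leg_time vP (waypoint z) (Suc n) - leg_time vP (waypoint z) n))"
    then have z: "sampled z" by (simp add: sampled_def)
    show "waypoint z n \<in> A" for n by (rule waypoint_in_A[OF z])
    show "\<exists>B. \<forall>n. leg_time vP (waypoint z) n \<le> B" "(\<lambda>n. waypoint z n - z n) \<longlonglongrightarrow> 0"
      by (rule chase[OF z])+
    show "\<forall>T\<in>L. \<delta> / 2 + vE * (leg_time vP (waypoint z) (Suc n) - leg_time vP (waypoint z) n) \<le> norm (T - z n)"
      for n
    proof
      fix T assume T: "T \<in> L"
      obtain y where y: "y \<in> D"
        "norm (y - z n) + vE * (leg_time vP (waypoint z) (Suc n) - leg_time vP (waypoint z) n) \<le> C * h"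
        using chase(3)[OF z, of n] by (auto simp: C_def D_def)
      have "\<delta> \<le> norm (T - y)" using \<delta>(2)[OF T y(1)] by (simp add: dist_norm)
      moreover have "norm (T - y) \<le> norm (T - z n) + norm (y - z n)" by norm
      ultimately show "\<delta> / 2 + vE * (leg_time vP (waypoint z) (Suc n) - leg_time vP (waypoint z) n) \<le> norm (T - z n)"
        using y(2) h_bounds(2) by linarith
    qed
  qed
  then show ?thesis by blast
qed

end


section \<open>The outcome of the game\<close>

text \<open>Recursion on the index: entry \<open>n\<close> is computed from a sequence that is
  already correct below \<open>n\<close>. In the application \<open>T z n\<close> is the time of
  observation \<open>n\<close> and \<open>m\<close> the motion of the evader.\<close>

lemma causal_fixpoint:
  fixes T :: "(nat \<Rightarrow> 'a) \<Rightarrow> nat \<Rightarrow> 'b"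
  assumes "\<And>z z' n. (\<And>k. k < n \<Longrightarrow> z k = z' k) \<Longrightarrow> T z n = T z' n"
  shows "\<exists>z. \<forall>n. z n = m (T z n)"
proof -
  define Z where "Z = rec_nat undefined (\<lambda>n z. z(n := m (T z n)))"
  have Z_Suc: "Z (Suc n) = (Z n)(n := m (T (Z n) n))" for n
    by (simp add: Z_def)
  have stable: "Z (Suc k + d) k = Z (Suc k) k" for k d
    by (induction d) (simp_all add: Z_Suc)
  have diag: "Z (Suc k) k = Z n k" if "k < n" for n k
    using stable[of k "n - Suc k"] that by simp
  have "T (\<lambda>k. Z (Suc k) k) n = T (Z n) n" for n
    using assms[of n "\<lambda>k. Z (Suc k) k" "Z n"] diag by blast
  then have "\<forall>n. Z (Suc n) n = m (T (\<lambda>k. Z (Suc k) k) n)"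
    by (simp add: Z_Suc)
  then show ?thesis by (intro exI[of _ "\<lambda>k. Z (Suc k) k"])
qed

text \<open>On the segment from \<open>T0\<close> to \<open>T\<close> the squared form of the
  inequality, right side minus left side, starts at 0 and stays nonnegative. The inner product is
  half its derivative at \<open>T0\<close>.\<close>

lemma tie_first_order:
  fixes L :: "'a::real_inner set"
  assumes L: "convex L" "T0 \<in> L" "T \<in> L" and ab: "0 \<le> a" "a < b"
    and tie: "b * norm (T0 - z) = a * norm (T0 - h)"
    and le: "\<And>T. T \<in> L \<Longrightarrow> a * norm (T - h) \<le> b * norm (T - z)"
  shows "0 \<le> (T - T0) \<bullet> (b\<^sup>2 *\<^sub>R (T0 - z) - a\<^sup>2 *\<^sub>R (T0 - h))"
proof (rule ccontr)
  define D where "D = T - T0"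
  define Y where "Y = T0 - z"
  define W where "W = T0 - h"
  define X where "X = D \<bullet> (b\<^sup>2 *\<^sub>R (T0 - z) - a\<^sup>2 *\<^sub>R (T0 - h))"
  define c where "c = (b\<^sup>2 - a\<^sup>2) * (norm D)\<^sup>2"
  assume "\<not> ?thesis"
  then have X: "X < 0" by (simp add: X_def D_def)
  have X': "X = b\<^sup>2 * (D \<bullet> Y) - a\<^sup>2 * (D \<bullet> W)"
    by (simp add: X_def Y_def W_def inner_diff_right)
  have "0 \<le> c" using ab by (simp add: c_def power_mono)
  \<comment> \<open>So small that the linear term \<open>2 * s * X\<close> outweighs
    \<open>s^2 * c\<close>; the denominator \<open>c + 1\<close> is positive even if
    \<open>D = 0\<close>.\<close>
  define s where "s = min 1 (- X / (c + 1))"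
  have s: "0 < s" "s \<le> 1" "s * c < - 2 * X"
  proof -
    show "0 < s" "s \<le> 1" using X \<open>0 \<le> c\<close> by (auto simp: s_def intro: divide_neg_pos)
    have "s * (c + 1) \<le> - X"
      using \<open>0 \<le> c\<close> mult_right_mono[of s "- X / (c + 1)" "c + 1"] by (simp add: s_def)
    then show "s * c < - 2 * X"
      using X \<open>0 < s\<close> by (simp add: algebra_simps)
  qed
  have "T0 + s *\<^sub>R D = (1 - s) *\<^sub>R T0 + s *\<^sub>R T"
    by (simp add: D_def algebra_simps)
  also have "\<dots> \<in> L"
    using L s by (intro convexD) auto
  finally have "a * norm (T0 + s *\<^sub>R D - h) \<le> b * norm (T0 + s *\<^sub>R D - z)"
    by (rule le)
  then have "(a * norm (W + s *\<^sub>R D))\<^sup>2 \<le> (b * norm (Y + s *\<^sub>R D))\<^sup>2"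
    using ab by (intro power_mono) (auto simp: W_def Y_def algebra_simps)
  moreover have "(norm (y + s *\<^sub>R D))\<^sup>2 = (norm y)\<^sup>2 + 2 * s * (D \<bullet> y) + s\<^sup>2 * (norm D)\<^sup>2" for y
    unfolding power2_norm_eq_inner
    by (simp add: inner_add_left inner_add_right inner_commute power2_eq_square)
  moreover have "(b * norm Y)\<^sup>2 = (a * norm W)\<^sup>2"
    using tie by (simp add: W_def Y_def)
  ultimately have "0 \<le> s\<^sup>2 * c + 2 * s * X"
    by (simp add: power_mult_distrib c_def X' algebra_simps)
  then have "0 \<le> s * (s * c + 2 * X)"
    by (simp add: power2_eq_square algebra_simps)
  with s show False by (simp add: zero_le_mult_iff)
qed

text \<open>
  On the barrier both sides have to run straight to the tie point \<open>T0\<close>. A displacement \<open>s\<close> of the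
  evader other than the optimal one makes the position strictly winning for the pursuer, at least
  for a time \<open>\<eta>\<close> that is short compared with the distance from \<open>T0\<close>.
\<close>

lemma tie_deviation:
  fixes L :: "'a::real_inner set"
  assumes L: "convex L" "T0 \<in> L" and ab: "0 < a" "a < b"
    and tie: "b * norm (T0 - z) = a * norm (T0 - h)"
    and le: "\<And>T. T \<in> L \<Longrightarrow> a * norm (T - h) \<le> b * norm (T - z)"
    and \<eta>: "0 < \<eta>" "b\<^sup>2 * (a * \<eta>) < (b\<^sup>2 - a\<^sup>2) * norm (T0 - z)"
    and s: "norm s \<le> a * \<eta>" "s \<noteq> (a * \<eta>) *\<^sub>R sgn (T0 - z)"
    and T: "T \<in> L"
  shows "a * norm (T - (h + (b * \<eta>) *\<^sub>R sgn (T0 - h))) < b * norm (T - (z + s))"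
proof -
  define r where "r = norm (T0 - z)"
  define \<mu> where "\<mu> = a * \<eta> / r"
  define c where "c = b\<^sup>2 - a\<^sup>2"
  define Y where "Y = T0 - z"
  define W where "W = T0 - h"
  define D where "D = T - T0"
  define q where "q = s - \<mu> *\<^sub>R Y"
  have ab2: "a\<^sup>2 < b\<^sup>2" using ab by (simp add: power_strict_mono)
  then have c: "0 < c" by (simp add: c_def)
  have "0 \<le> b\<^sup>2 * (a * \<eta>)" using ab \<eta> by simp
  with \<eta>(2) have "0 < c * r" unfolding r_def c_def by linarith
  with c have r: "0 < r" by (simp add: zero_less_mult_iff)
  have \<mu>: "0 < \<mu>" "b\<^sup>2 * \<mu> < c"
    using ab \<eta> r by (auto simp: \<mu>_def c_def r_def field_simps)
  have "\<mu> < 1"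
  proof -
    have "c \<le> b\<^sup>2 * 1" by (simp add: c_def)
    with \<mu> have "b\<^sup>2 * \<mu> < b\<^sup>2 * 1" by linarith
    then show ?thesis using ab by (simp only: mult_less_cancel_left_pos zero_less_power)
  qed
  have muY: "(a * \<eta>) *\<^sub>R sgn (T0 - z) = \<mu> *\<^sub>R Y"
    by (simp add: \<mu>_def Y_def sgn_div_norm r_def divide_inverse)
  have "b * r = a * norm W" using tie by (simp add: r_def W_def)
  then have muW: "(b * \<eta>) *\<^sub>R sgn (T0 - h) = \<mu> *\<^sub>R W"
  proof -
    have "norm W = b * r / a" using \<open>b * r = a * norm W\<close> ab by simp
    then have "b * \<eta> / norm W = \<mu>" using ab r by (simp add: \<mu>_def)
    then show ?thesis by (simp add: sgn_div_norm divide_inverse W_def)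
  qed
  have q: "q \<noteq> 0" using s(2) muY by (simp add: q_def)
  have nY: "norm Y = r" by (simp add: Y_def r_def)
  \<comment> \<open>The speed limit on \<open>s\<close> gives any deviation \<open>q\<close> a
    component against \<open>Y\<close>, of second order in \<open>q\<close>.\<close>
  have "(norm (q + \<mu> *\<^sub>R Y))\<^sup>2 \<le> (\<mu> * norm Y)\<^sup>2"
    using s(1) r nY by (intro power_mono) (auto simp: q_def \<mu>_def)
  moreover have "(norm (q + \<mu> *\<^sub>R Y))\<^sup>2 = (norm q)\<^sup>2 + 2 * \<mu> * (q \<bullet> Y) + \<mu>\<^sup>2 * (norm Y)\<^sup>2"
    unfolding power2_norm_eq_inner
    by (simp add: inner_add_left inner_add_right inner_commute power2_eq_square)
  ultimately have qY: "(norm q)\<^sup>2 \<le> - 2 * \<mu> * (q \<bullet> Y)"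
    by (simp add: power_mult_distrib)
  have first: "0 \<le> D \<bullet> (b\<^sup>2 *\<^sub>R Y - a\<^sup>2 *\<^sub>R W)"
    unfolding D_def Y_def W_def using tie_first_order[OF L T _ ab(2) tie le] ab by simp
  define N where "N = b\<^sup>2 * (norm (T - (z + s)))\<^sup>2 - a\<^sup>2 * (norm (T - (h + \<mu> *\<^sub>R W)))\<^sup>2"
  have Tz: "T - (z + s) = D + (1 - \<mu>) *\<^sub>R Y - q"
    by (simp add: D_def Y_def q_def algebra_simps)
  have Th: "T - (h + \<mu> *\<^sub>R W) = D + (1 - \<mu>) *\<^sub>R W"
    by (simp add: D_def W_def algebra_simps)
  have tie2: "b\<^sup>2 * (Y \<bullet> Y) = a\<^sup>2 * (W \<bullet> W)"
    using tie unfolding Y_def W_def power2_norm_eq_inner[symmetric] power_mult_distrib[symmetric] by simp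
  have N: "N = c * (norm D)\<^sup>2 + 2 * (1 - \<mu>) * (D \<bullet> (b\<^sup>2 *\<^sub>R Y - a\<^sup>2 *\<^sub>R W))
      - 2 * b\<^sup>2 * (q \<bullet> D) - 2 * b\<^sup>2 * (1 - \<mu>) * (q \<bullet> Y) + b\<^sup>2 * (norm q)\<^sup>2
      + (1 - \<mu>)\<^sup>2 * (b\<^sup>2 * (Y \<bullet> Y) - a\<^sup>2 * (W \<bullet> W))"
    unfolding N_def Tz Th c_def power2_norm_eq_inner
    by (simp add: inner_add_left inner_add_right inner_diff_left inner_diff_right inner_commute
        power2_eq_square algebra_simps)
  have "(1 - \<mu>) / \<mu> * (norm q)\<^sup>2 \<le> - 2 * (1 - \<mu>) * (q \<bullet> Y)"
  proof -
    have "(1 - \<mu>) / \<mu> * (norm q)\<^sup>2 \<le> (1 - \<mu>) / \<mu> * (- 2 * \<mu> * (q \<bullet> Y))"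
      using qY \<mu> \<open>\<mu> < 1\<close> by (intro mult_left_mono) auto
    also have "\<dots> = - 2 * (1 - \<mu>) * (q \<bullet> Y)"
      using \<mu> by (simp add: field_simps)
    finally show ?thesis .
  qed
  then have "b\<^sup>2 * ((1 - \<mu>) / \<mu> * (norm q)\<^sup>2) \<le> b\<^sup>2 * (- 2 * (1 - \<mu>) * (q \<bullet> Y))"
    by (rule mult_left_mono) simp
  moreover have "b\<^sup>2 * ((1 - \<mu>) / \<mu> * (norm q)\<^sup>2) + b\<^sup>2 * (norm q)\<^sup>2 = b\<^sup>2 / \<mu> * (norm q)\<^sup>2"
    using \<mu> by (simp add: field_simps)
  moreover have "0 \<le> 2 * (1 - \<mu>) * (D \<bullet> (b\<^sup>2 *\<^sub>R Y - a\<^sup>2 *\<^sub>R W))"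
    using first \<open>\<mu> < 1\<close> by simp
  moreover have "2 * b\<^sup>2 * (q \<bullet> D) \<le> 2 * b\<^sup>2 * (norm q * norm D)"
    using norm_cauchy_schwarz[of q D] by (intro mult_left_mono) auto
  ultimately have lower: "c * (norm D)\<^sup>2 - 2 * b\<^sup>2 * (norm q * norm D) + b\<^sup>2 / \<mu> * (norm q)\<^sup>2 \<le> N"
    unfolding N tie2 by (simp add: algebra_simps)
  \<comment> \<open>Completing the square in \<open>norm D\<close>. The assumption on
    \<open>\<eta>\<close> amounts to \<open>b^2 * \<mu> < c\<close>, which makes the remainder
    positive.\<close>
  have "c * (c * (norm D)\<^sup>2 - 2 * b\<^sup>2 * (norm q * norm D) + b\<^sup>2 / \<mu> * (norm q)\<^sup>2)
      = (c * norm D - b\<^sup>2 * norm q)\<^sup>2 + b\<^sup>2 * (norm q)\<^sup>2 * (c / \<mu> - b\<^sup>2)"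
    by (simp add: power2_eq_square algebra_simps)
  moreover have "0 < b\<^sup>2 * (norm q)\<^sup>2 * (c / \<mu> - b\<^sup>2)"
    using q ab \<mu> by (intro mult_pos_pos) (auto simp: field_simps)
  ultimately have "0 < c * (c * (norm D)\<^sup>2 - 2 * b\<^sup>2 * (norm q * norm D) + b\<^sup>2 / \<mu> * (norm q)\<^sup>2)"
    by (simp add: add_nonneg_pos)
  with c lower have "0 < N" by (simp add: zero_less_mult_iff)
  then have "(a * norm (T - (h + \<mu> *\<^sub>R W)))\<^sup>2 < (b * norm (T - (z + s)))\<^sup>2"
    by (simp add: N_def power_mult_distrib)
  then show ?thesis
    unfolding muW using ab by (auto intro: power2_less_imp_less)
qed

section \<open>Straight runs and concatenation inside the arena\<close>

context arena
begin

text \<open>Repeating the waypoint \<open>y\<close> makes all later legs empty, so the default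
  control takes over on arrival.\<close>

definition straight :: "real \<Rightarrow> plane \<Rightarrow> plane \<Rightarrow> real \<Rightarrow> plane" where
  "straight v x y = polygonal_control A v (case_nat x (\<lambda>_. y))"

lemma admissible_straight: "0 < v \<Longrightarrow> x \<in> A \<Longrightarrow> y \<in> A \<Longrightarrow> admissible A v x (straight v x y)"
  unfolding straight_def using admissible_polygonal[of v "case_nat x (\<lambda>_. y)"]
  by (auto split: nat.split)

lemma motion_straight:
  assumes "0 < v" "0 \<le> t" "t \<le> norm (y - x) / v"
  shows "motion v x (straight v x y) t = x + (v * t) *\<^sub>R sgn (y - x)"
  using motion_waypoint_leg[of v _ "case_nat x (\<lambda>_. y)" 0 t, OF assms(1) control_shift[OF control_default[OF assms(1)]]]
    assms
  by (simp add: straight_def polygonal_control_def leg_time_Suc)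

lemma admissible_concat:
  assumes "admissible A v x u" "admissible A v (motion v x u s) w" "0 \<le> s"
  shows "admissible A v x (concat_control u s w)"
  unfolding admissible_def
proof (intro conjI allI impI)
  show "control (concat_control u s w)"
    using assms by (intro control_concat) (auto simp: admissible_def)
  fix t :: real assume "0 \<le> t"
  then show "motion v x (concat_control u s w) t \<in> A"
    using assms motion_concat_before[of t s v x u w] motion_concat_after[of u w s t v x]
    by (cases "t \<le> s") (auto simp: admissible_def)
qed

end

text \<open>The assumption \<open>entry\<close> says that the evader enters \<open>G\<close> through \<open>L\<close>.\<close>

locale reach_avoid = arena +
  fixes G S L :: "plane set" and vP vE :: real
  assumes v: "0 < vE" "vE < vP"
    and L: "compact L" "convex L" "L \<subseteq> G" "L \<subseteq> A"
    and S: "S \<subseteq> A" "S \<inter> G = {}"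
    and entry: "\<And>(\<phi> :: real \<Rightarrow> plane) s. 0 \<le> s \<Longrightarrow> continuous_on {0..s} \<phi> \<Longrightarrow> \<phi> ` {0..s} \<subseteq> A \<Longrightarrow>
      \<phi> 0 \<in> S \<Longrightarrow> \<phi> s \<in> G \<Longrightarrow> \<exists>t\<in>{0..s}. \<phi> t \<in> L"
    and sight: "\<And>x T s. x \<in> S \<Longrightarrow> T \<in> L \<Longrightarrow> 0 \<le> s \<Longrightarrow> s < 1 \<Longrightarrow> x + s *\<^sub>R (T - x) \<notin> G"
begin

lemma vP: "0 < vP" using v by simp

lemma motion_entry:
  assumes "control u" "0 \<le> s" "\<And>t. t \<in> {0..s} \<Longrightarrow> motion vE x u t \<in> A" "x \<in> S" "motion vE x u s \<in> G"
  shows "\<exists>t\<in>{0..s}. motion vE x u t \<in> L"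
proof (rule entry[OF assms(2)])
  show "continuous_on {0..s} (motion vE x u)"
    using continuous_on_subset[OF continuous_on_motion] assms(1) v by auto
qed (use assms in auto)

lemma pursuit_wins:
  assumes x: "x \<in> S" and p0: "p0 \<in> A"
    and sep: "\<And>T. T \<in> L \<Longrightarrow> vE * norm (T - p0) < vP * norm (T - x)"
  shows "x \<in> pursuit_winning_region A G S vP vE (\<lambda>_::unit. p0)"
proof -
  obtain \<sigma> \<epsilon> where \<sigma>: "guarding_strategy L vP vE p0 x \<sigma> \<epsilon>"
    using ex_guarding_strategy[OF v p0 _ L(1) sep] x S by blast
  note \<epsilon> = guarding_strategyD(1)[OF \<sigma>] and \<sigma>0 = guarding_strategyD(2)[OF \<sigma>]
    and causal = guarding_strategyD(3)[OF \<sigma>] and leg_causal = guarding_strategyD(4)[OF \<sigma>]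
  have ex: "\<exists>z. \<forall>n. z n = motion vE x u (leg_time vP (\<sigma> z) n)" for u
    by (rule causal_fixpoint[of "\<lambda>z. leg_time vP (\<sigma> z)"]) (rule leg_causal)
  define Z where "Z u = (SOME z. \<forall>n. z n = motion vE x u (leg_time vP (\<sigma> z) n))" for u
  have Z: "Z u n = motion vE x u (leg_time vP (\<sigma> (Z u)) n)" for u n
    unfolding Z_def using someI_ex[OF ex[of u]] by blast
  define \<beta> where "\<beta> u (k::unit) = polygonal_control A vP (\<sigma> (Z u))" for u k
  have "nonanticipative (admissible A vE x) \<beta>"
    unfolding nonanticipative_def
  proof (intro allI impI ballI)
    fix u u' :: "real \<Rightarrow> plane" and t s :: real and k :: unit
    assume eq: "admissible A vE x u \<and> admissible A vE x u' \<and> (\<forall>s\<in>{0..t}. u s = u' s)" and s: "s \<in> {0..t}"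
    \<comment> \<open>Strong induction: equal earlier observations give equal times for the next
      one, and until then the two controls agree.\<close>
    have same: "Z u n = Z u' n" if "leg_time vP (\<sigma> (Z u)) n \<le> s" for n
      using that
    proof (induction n rule: less_induct)
      case (less n)
      then have "Z u k = Z u' k" if "k < n" for k
        using that leg_time_mono[OF vP, of k n "\<sigma> (Z u)"] by (meson less_imp_le order_trans)
      then have leg: "leg_time vP (\<sigma> (Z u)) n = leg_time vP (\<sigma> (Z u')) n"
        by (rule leg_causal)
      have "motion vE x u (leg_time vP (\<sigma> (Z u)) n) = motion vE x u' (leg_time vP (\<sigma> (Z u)) n)"
        using eq less.prems s by (intro motion_cong) auto
      then show ?case using Z[of u n] Z[of u' n] leg by simp
    qed
    show "\<beta> u k s = \<beta> u' k s"
      unfolding \<beta>_def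
    proof (rule polygonal_control_cong[OF vP])
      fix n assume n: "leg_time vP (\<sigma> (Z u)) n \<le> s"
      have "Z u k = Z u' k" if "k \<le> n" for k
        using n that leg_time_mono[OF vP, of k n "\<sigma> (Z u)"] by (intro same) simp
      then show "\<sigma> (Z u) (Suc n) = \<sigma> (Z u') (Suc n)"
        by (intro causal) auto
    qed (use s \<sigma>0 in auto)
  qed
  moreover have "(\<forall>k. admissible A vP p0 (\<beta> u k)) \<and>
      (\<exists>t\<ge>0. (\<exists>k. motion vP p0 (\<beta> u k) t = motion vE x u t) \<and> (\<forall>s\<in>{0..t}. motion vE x u s \<notin> G))"
    if u: "admissible A vE x u" for u
  proof -
    define z where "z = Z u"
    define t where "t = leg_time vP (\<sigma> z)"
    have cu: "control u" and inA: "\<And>t. 0 \<le> t \<Longrightarrow> motion vE x u t \<in> A"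
      using u by (auto simp: admissible_def)
    have zt: "z n = motion vE x u (t n)" for n
      using Z[of u n] by (simp add: z_def t_def)
    have t0: "0 \<le> t n" "t n \<le> t (Suc n)" for n
      using leg_time_nonneg[OF vP] leg_time_mono[OF vP, of n "Suc n"] by (auto simp: t_def)
    have "z 0 = x" by (simp add: zt) (simp add: t_def)
    moreover have "norm (z (Suc n) - z n) \<le> vE * (t (Suc n) - t n)" for n
      unfolding zt using cu v t0 by (intro motion_lipschitz) auto
    moreover have "z n \<in> A" for n
      using inA[OF t0(1)] by (simp add: zt)
    ultimately have \<sigma>A: "\<And>n. \<sigma> z n \<in> A" and bdd: "\<exists>B. \<forall>n. t n \<le> B"
      and meet: "(\<lambda>n. \<sigma> z n - z n) \<longlonglongrightarrow> 0"
      and far: "\<And>n T. T \<in> L \<Longrightarrow> \<epsilon> + vE * (t (Suc n) - t n) \<le> norm (T - z n)"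
      using guarding_strategy_play[OF \<sigma>, of z] unfolding t_def by blast+
    obtain B where B: "\<And>n. leg_time vP (\<sigma> z) n \<le> B" using bdd by (auto simp: t_def)
    define tc where "tc = lim t"
    note lim = polygonal_limit[OF vP B, folded t_def, folded tc_def]
    have tc: "0 \<le> tc" using lim(2)[of 0] t0(1)[of 0] by linarith
    have z_lim: "z \<longlonglongrightarrow> motion vE x u tc"
      unfolding zt using t0 tc v cu
      by (intro continuous_on_tendsto_compose[OF continuous_on_motion lim(1)]) auto
    have "motion vP p0 (\<beta> u k) tc = motion vE x u tc" for k
    proof (rule LIMSEQ_unique)
      show "\<sigma> z \<longlonglongrightarrow> motion vP p0 (\<beta> u k) tc"
        using lim(4) by (simp add: \<beta>_def z_def \<sigma>0)
      show "\<sigma> z \<longlonglongrightarrow> motion vE x u tc"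
        using tendsto_add[OF meet z_lim] by simp
    qed
    moreover have off_L: "motion vE x u s \<notin> L" if s: "0 \<le> s" "s \<le> tc" for s
    proof (rule leg_time_cases[OF vP s(1), of "\<sigma> z", folded t_def])
      fix n assume n: "t n \<le> s" "s < t (Suc n)"
      have "norm (motion vE x u s - z n) \<le> vE * (s - t n)"
        unfolding zt using cu v t0 n by (intro motion_lipschitz) auto
      also have "\<dots> \<le> vE * (t (Suc n) - t n)"
        using n v by (intro mult_left_mono) auto
      finally show ?thesis
        using far[of "motion vE x u s" n] \<epsilon> by auto
    next
      \<comment> \<open>At the accumulation point of the observation times no leg is active; the
        margin \<open>\<epsilon>\<close> is the same for all \<open>n\<close> and survives the
        limit.\<close>
      assume "\<And>n. t n \<le> s"
      then have "s = tc" using LIMSEQ_le_const2[OF lim(1)] s by force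
      have "(\<lambda>n. norm (motion vE x u tc - z n)) \<longlonglongrightarrow> 0"
        using tendsto_norm[OF tendsto_diff[OF tendsto_const z_lim, of "motion vE x u tc"]] by simp
      then obtain n where n: "norm (motion vE x u tc - z n) < \<epsilon>"
        using \<epsilon> order_tendstoD(2)[of _ 0 sequentially \<epsilon>] by (auto simp: eventually_sequentially)
      have "0 \<le> vE * (t (Suc n) - t n)" using v t0 by simp
      with n far[of "motion vE x u tc" n] show ?thesis
        unfolding \<open>s = tc\<close> by linarith
    qed
    have "motion vE x u s \<notin> G" if "s \<in> {0..tc}" for s
      using motion_entry[OF cu _ inA x, of s] off_L that by fastforce
    moreover have "admissible A vP p0 (\<beta> u k)" for k
      using admissible_polygonal[OF vP, of "\<sigma> z"] \<sigma>A by (simp add: \<beta>_def z_def \<sigma>0)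
    ultimately show ?thesis using tc by blast
  qed
  ultimately show ?thesis
    using x unfolding pursuit_winning_region_def by blast
qed

text \<open>The evader runs straight to \<open>T\<close>. A capture needs a meeting outside
  \<open>G\<close>, hence strictly before arrival; from the meeting point the evader's remaining way
  would then lead the pursuer to \<open>T\<close> in less total length than
  \<open>norm (T - p0)\<close>.\<close>

lemma tie_not_pursuit:
  assumes x: "x \<in> S" and T: "T \<in> L" "vP * norm (T - x) = vE * norm (T - p0)"
  shows "x \<notin> pursuit_winning_region A G S vP vE (\<lambda>_::unit. p0)"
proof
  assume "x \<in> pursuit_winning_region A G S vP vE (\<lambda>_::unit. p0)"
  moreover define u where "u = straight vE x T"
  moreover have "admissible A vE x u"
    unfolding u_def using v x S T L by (intro admissible_straight) auto
  ultimately obtain w t where w: "admissible A vP p0 w" and t: "0 \<le> t"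
    and meet: "motion vP p0 w t = motion vE x u t"
    and free: "\<And>s. s \<in> {0..t} \<Longrightarrow> motion vE x u s \<notin> G"
    unfolding pursuit_winning_region_def by blast
  define r where "r = norm (T - x)"
  have u: "motion vE x u s = x + (vE * s) *\<^sub>R sgn (T - x)" if "0 \<le> s" "s \<le> r / vE" for s
    unfolding u_def using motion_straight[of vE s T x] v that by (simp add: r_def)
  have rsgn: "r *\<^sub>R sgn (T - x) = T - x"
    by (cases "T = x") (simp_all add: r_def sgn_div_norm)
  have "motion vE x u (r / vE) = T"
    using u[of "r / vE"] v rsgn by (simp add: r_def)
  moreover have "0 \<le> r / vE" using v by (simp add: r_def)
  ultimately have lt: "t < r / vE"
    using free[of "r / vE"] T L by (force simp: not_less)
  have "T - motion vE x u t = (r - vE * t) *\<^sub>R sgn (T - x)"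
    using u[of t] t lt rsgn by (simp add: scaleR_left_diff_distrib)
  moreover have "x \<noteq> T" using x T S L by auto
  moreover have "0 \<le> r - vE * t" using lt v by (simp add: field_simps)
  ultimately have "norm (T - motion vE x u t) = r - vE * t"
    by (simp add: norm_sgn)
  moreover have "norm (motion vP p0 w t - p0) \<le> vP * t"
    using motion_lipschitz[of w vP 0 t p0] w t vP by (simp add: admissible_def)
  moreover have "norm (T - p0) \<le> norm (T - motion vP p0 w t) + norm (motion vP p0 w t - p0)"
    by norm
  ultimately have "norm (T - p0) \<le> r + (vP - vE) * t"
    using meet by (simp add: algebra_simps)
  then have "vE * norm (T - p0) \<le> vE * r + (vP - vE) * (vE * t)"
    using v mult_left_mono[of "norm (T - p0)" "r + (vP - vE) * t" vE] by (simp add: algebra_simps)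
  also have "\<dots> < vE * r + (vP - vE) * r"
    using lt v mult_strict_left_mono[of "vE * t" r "vP - vE"] by (simp add: field_simps)
  also have "\<dots> = vP * r" by (simp add: algebra_simps)
  finally show False using T by (simp add: r_def)
qed

text \<open>A constant feedback determines the play uniquely, so nothing can get stuck. By
  \<open>sight\<close> the run meets \<open>G\<close> only at \<open>T\<close>, and the strict
  inequality excludes a meeting even at the moment of arrival.\<close>

lemma evasion_wins:
  assumes x: "x \<in> S" and T: "T \<in> L" "vP * norm (T - x) < vE * norm (T - p0)"
  shows "x \<in> evasion_winning_region A G S vP vE (\<lambda>_::unit. p0)"
proof -
  define r where "r = norm (T - x)"
  define e where "e = sgn (T - x)"
  have "x \<noteq> T" using x T S L by auto
  then have e: "norm e = 1" and r: "0 < r" by (auto simp: e_def norm_sgn r_def)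
  have rsgn: "r *\<^sub>R e = T - x"
    using \<open>x \<noteq> T\<close> by (simp add: r_def e_def sgn_div_norm)
  have ctrl: "motion vE x (\<lambda>_. e) t = x + (vE * t) *\<^sub>R e" if "0 \<le> t" for t
    using that by (simp add: motion_def)
  have seg_A: "x + s *\<^sub>R e \<in> A" if "0 \<le> s" "s \<le> r" for s
  proof -
    have "x + s *\<^sub>R e = (1 - s / r) *\<^sub>R x + (s / r) *\<^sub>R (x + r *\<^sub>R e)"
      using r by (simp add: algebra_simps)
    also have "\<dots> = (1 - s / r) *\<^sub>R x + (s / r) *\<^sub>R T"
      by (simp add: rsgn)
    also have "\<dots> \<in> A"
      using that r convex x S T L by (intro convexD) auto
    finally show ?thesis .
  qed
  have seg: "x + s *\<^sub>R e \<notin> G" if "0 \<le> s" "s < r" for s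
    using sight[OF x T(1), of "s / r"] that r by (simp add: flip: rsgn)
  let ?\<gamma> = "\<lambda>(_ :: unit \<Rightarrow> plane) (_ :: plane). e"
  have play: "motion vE x u t = x + (vE * t) *\<^sub>R e" "s \<le> r / vE"
    if pl: "evader_play A G vE ?\<gamma> P x u s" and "0 \<le> t" "t \<le> s" for P u s and t :: real
  proof -
    have *: "motion vE x u t = x + (vE * t) *\<^sub>R e" if "0 \<le> t" "t \<le> s" for t
      using motion_cong[of t u "\<lambda>_. e" vE x] ctrl pl that by (simp add: evader_play_def)
    from *[OF that(2,3)] show "motion vE x u t = x + (vE * t) *\<^sub>R e" .
    show "s \<le> r / vE"
    proof (rule ccontr)
      assume "\<not> ?thesis"
      moreover have "0 \<le> r / vE" using r v by simp
      ultimately have "motion vE x u (r / vE) = T" "motion vE x u (r / vE) \<notin> G"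
        using *[of "r / vE"] rsgn v pl by (auto simp: evader_play_def)
      with T L show False by auto
    qed
  qed
  have full: "evader_play A G vE ?\<gamma> P x (\<lambda>_. e) (r / vE)" for P
    using e r v seg seg_A ctrl
    by (auto simp: evader_play_def control_constant field_simps simp flip: e_def r_def)
  have "motion vE x (\<lambda>_. e) (r / vE) = T"
    using ctrl[of "r / vE"] r v rsgn by simp
  then have arrive: "motion vE x (\<lambda>_. e) (r / vE) \<in> G" using T L by auto
  show ?thesis
    unfolding evasion_winning_region_def
  proof (intro CollectI conjI x exI[of _ ?\<gamma>] allI impI ballI)
    fix U :: "unit \<Rightarrow> real \<Rightarrow> plane" and P u s t and k :: unit
    assume UP: "(\<forall>k. admissible A vP p0 (U k)) \<and> P = (\<lambda>t k. motion vP p0 (U k) t)"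
      and pl: "evader_play A G vE ?\<gamma> P x u s" and t: "t \<in> {0..s}"
    have tr: "motion vE x u t = x + (vE * t) *\<^sub>R e" and "s \<le> r / vE"
      using play[OF pl, of t] t by auto
    then have tr_le: "vE * t \<le> r"
      using t v by (simp add: pos_le_divide_eq) (metis mult.commute mult_left_mono less_imp_le order_trans)
    show "P t k \<noteq> motion vE x u t"
    proof
      assume meet: "P t k = motion vE x u t"
      have "T - motion vE x u t = (r - vE * t) *\<^sub>R e"
        unfolding tr scaleR_left_diff_distrib rsgn by simp
      then have 1: "norm (T - motion vE x u t) = r - vE * t"
        using tr_le e by simp
      have 2: "norm (motion vP p0 (U k) t - p0) \<le> vP * t"
        using motion_lipschitz[of "U k" vP 0 t p0] UP t vP by (simp add: admissible_def)
      have "norm (T - p0) \<le> norm (T - P t k) + norm (P t k - p0)" by norm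
      then have "norm (T - p0) \<le> r + (vP - vE) * t"
        using 1 2 meet UP by (simp add: algebra_simps)
      then have "vE * norm (T - p0) \<le> vE * r + (vP - vE) * (vE * t)"
        using v mult_left_mono[of "norm (T - p0)" "r + (vP - vE) * t" vE] by (simp add: algebra_simps)
      also have "\<dots> \<le> vE * r + (vP - vE) * r"
        using tr_le v by simp
      also have "\<dots> = vP * r" by (simp add: algebra_simps)
      finally show False using T by (simp add: r_def)
    qed
  next
    fix U :: "unit \<Rightarrow> real \<Rightarrow> plane" and P u s
    assume pl: "evader_play A G vE ?\<gamma> P x u s"
    have "s \<le> r / vE" using play(2)[OF pl, of s] pl by (auto simp: evader_play_def)
    with full arrive show "\<exists>u' s'. s \<le> s' \<and> (\<forall>t\<in>{0..<s}. u' t = u t) \<and>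
        evader_play A G vE ?\<gamma> P x u' s' \<and> motion vE x u' s' \<in> G"
      using pl by (intro exI[of _ "\<lambda>_. e"] exI[of _ "r / vE"]) (auto simp: evader_play_def)
  next
    fix U :: "unit \<Rightarrow> real \<Rightarrow> plane" and P u
    show "\<exists>s\<ge>0. \<not> evader_play A G vE ?\<gamma> P x u s"
      using play(2)[of P u "r / vE + 1" 0] r v by (intro exI[of _ "r / vE + 1"]) auto
  qed (use e in auto)
qed

end


section \<open>Plays against a winning feedback\<close>

lemma evader_play_restrict:
  assumes "evader_play A G v \<gamma> P x u s" "0 \<le> s'" "s' \<le> s"
    and "\<And>t. 0 \<le> t \<Longrightarrow> t < s' \<Longrightarrow> P' t = P t"
  shows "evader_play A G v \<gamma> P' x u s'"
  using assms by (auto simp: evader_play_def)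

definition guarantees_arrival ::
  "plane set \<Rightarrow> plane set \<Rightarrow> real \<Rightarrow> real \<Rightarrow> ((unit \<Rightarrow> plane) \<Rightarrow> plane \<Rightarrow> plane) \<Rightarrow> plane \<Rightarrow> plane \<Rightarrow> bool" where
  "guarantees_arrival A G vP vE \<gamma> p0 x \<longleftrightarrow>
     (\<forall>U u s. admissible A vP p0 U \<and> evader_play A G vE \<gamma> (\<lambda>t _. motion vP p0 U t) x u s \<longrightarrow>
        (\<forall>t\<in>{0..s}. motion vP p0 U t \<noteq> motion vE x u t) \<and>
        (\<exists>u' s'. s \<le> s' \<and> (\<forall>t\<in>{0..<s}. u' t = u t) \<and>
           evader_play A G vE \<gamma> (\<lambda>t _. motion vP p0 U t) x u' s' \<and> motion vE x u' s' \<in> G))"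

lemma guarantees_arrivalD:
  assumes "guarantees_arrival A G vP vE \<gamma> p0 x" and "admissible A vP p0 U"
    and "evader_play A G vE \<gamma> (\<lambda>t _. motion vP p0 U t) x u s"
  shows "\<forall>t\<in>{0..s}. motion vP p0 U t \<noteq> motion vE x u t"
    and "\<exists>u' s'. s \<le> s' \<and> (\<forall>t\<in>{0..<s}. u' t = u t) \<and>
      evader_play A G vE \<gamma> (\<lambda>t _. motion vP p0 U t) x u' s' \<and> motion vE x u' s' \<in> G"
  using assms(1)[unfolded guarantees_arrival_def, rule_format, OF conjI, OF assms(2,3)] by auto

lemma evasion_guarantee:
  assumes "x \<in> evasion_winning_region A G S vP vE (\<lambda>_::unit. p0)"
  obtains \<gamma> where "guarantees_arrival A G vP vE \<gamma> p0 x"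
proof -
  obtain \<gamma> where \<gamma>: "\<forall>U P. (\<forall>k::unit. admissible A vP p0 (U k)) \<and> P = (\<lambda>t k. motion vP p0 (U k) t) \<longrightarrow>
      (\<forall>u s. evader_play A G vE \<gamma> P x u s \<longrightarrow>
        (\<forall>t\<in>{0..s}. \<forall>k. P t k \<noteq> motion vE x u t) \<and>
        (\<exists>u' s'. s \<le> s' \<and> (\<forall>t\<in>{0..<s}. u' t = u t) \<and>
           evader_play A G vE \<gamma> P x u' s' \<and> motion vE x u' s' \<in> G)) \<and>
      (\<forall>u. \<exists>s\<ge>0. \<not> evader_play A G vE \<gamma> P x u s)"
    using assms unfolding evasion_winning_region_def by (elim CollectE conjE exE) (rule that)
  have "guarantees_arrival A G vP vE \<gamma> p0 x"
    unfolding guarantees_arrival_def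
  proof (intro allI impI)
    fix U u s
    assume *: "admissible A vP p0 U \<and> evader_play A G vE \<gamma> (\<lambda>t _. motion vP p0 U t) x u s"
    show "(\<forall>t\<in>{0..s}. motion vP p0 U t \<noteq> motion vE x u t) \<and>
        (\<exists>u' s'. s \<le> s' \<and> (\<forall>t\<in>{0..<s}. u' t = u t) \<and>
           evader_play A G vE \<gamma> (\<lambda>t _. motion vP p0 U t) x u' s' \<and> motion vE x u' s' \<in> G)"
      using \<gamma>[rule_format, of "\<lambda>_. U" "\<lambda>t _. motion vP p0 U t", THEN conjunct1, rule_format, of u s] *
      by auto
  qed
  then show thesis by (rule that)
qed

context reach_avoid
begin

text \<open>\<open>entry\<close> yields some time on \<open>L\<close>; since a play avoids
  \<open>G\<close> before its final time, it can only be the final one.\<close>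

lemma arrival_in_L:
  assumes "evader_play A G vE \<gamma> P x u s" "x \<in> S" "motion vE x u s \<in> G"
  shows "motion vE x u s \<in> L"
proof -
  obtain t where t: "t \<in> {0..s}" "motion vE x u t \<in> L"
    using motion_entry[of u s x] assms by (auto simp: evader_play_def)
  then have "motion vE x u t \<in> G" using L by blast
  then have "\<not> t < s" using assms(1) t by (auto simp: evader_play_def)
  with t show ?thesis by (cases "t = s") auto
qed

text \<open>
  The sampled pursuit strategy looks at the evader only at discrete times, so it can be played
  against a feedback: play and pursuit are built up together, one leg of the pursuer at a time.
\<close>

lemma feedback_capture:
  assumes x: "x \<in> S" and win: "guarantees_arrival A G vP vE \<gamma> p0 x"
    and U0: "admissible A vP p0 U0"
    and u0: "evader_play A G vE \<gamma> (\<lambda>t _. motion vP p0 U0 t) x u0 t1"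
    and sep: "\<And>T. T \<in> L \<Longrightarrow> vE * norm (T - motion vP p0 U0 t1) < vP * norm (T - motion vE x u0 t1)"
  shows False
proof -
  define p1 where "p1 = motion vP p0 U0 t1"
  define z1 where "z1 = motion vE x u0 t1"
  have t1: "0 \<le> t1" and z1: "z1 \<in> A"
    using u0 by (auto simp: evader_play_def z1_def)
  have p1: "p1 \<in> A" using U0 t1 by (simp add: p1_def admissible_def)
  have cU0: "control U0" using U0 by (simp add: admissible_def)
  obtain \<sigma> \<epsilon> where \<sigma>: "guarding_strategy L vP vE p1 z1 \<sigma> \<epsilon>"
    using ex_guarding_strategy[OF v p1 z1 L(1)] sep unfolding p1_def z1_def by blast
  note \<epsilon> = guarding_strategyD(1)[OF \<sigma>] and \<sigma>0 = guarding_strategyD(2)[OF \<sigma>]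
    and causal = guarding_strategyD(3)[OF \<sigma>] and leg_causal = guarding_strategyD(4)[OF \<sigma>]
  define W where "W z = concat_control U0 t1 (polygonal_control A vP (\<sigma> z))" for z
  define Q where "Q z t (k::unit) = motion vP p0 (W z) t" for z t k
  have Q_eq: "Q z = (\<lambda>t _. motion vP p0 (W z) t)" for z
    by (simp add: Q_def fun_eq_iff)
  define \<tau> where "\<tau> z n = t1 + leg_time vP (\<sigma> z) n" for z n
  have \<tau>0: "\<tau> z 0 = t1" for z by (simp add: \<tau>_def)
  have \<tau>_mono: "\<tau> z m \<le> \<tau> z n" if "m \<le> n" for z m n
    using leg_time_mono[OF vP that] by (simp add: \<tau>_def)
  have \<tau>_diff: "0 \<le> vE * (\<tau> z (Suc n) - \<tau> z n)" for z n
    using v \<tau>_mono[of n "Suc n" z] by simp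
  have \<tau>_ge: "t1 \<le> \<tau> z n" "0 \<le> \<tau> z n" for z n
    using \<tau>_mono[of 0 n z] \<tau>0[of z] t1 by auto
  define legal where "legal z \<longleftrightarrow> z 0 = z1 \<and> (\<forall>n. z n \<in> A) \<and>
    (\<forall>n. norm (z (Suc n) - z n) \<le> vE * (\<tau> z (Suc n) - \<tau> z n))" for z
  have legal: "\<sigma> z n \<in> A" "\<exists>B. \<forall>n. leg_time vP (\<sigma> z) n \<le> B" "(\<lambda>n. \<sigma> z n - z n) \<longlonglongrightarrow> 0"
    "T \<in> L \<Longrightarrow> \<epsilon> + vE * (\<tau> z (Suc n) - \<tau> z n) \<le> norm (T - z n)" if "legal z" for z n T
    using guarding_strategy_play[OF \<sigma>, of z] that by (auto simp: legal_def \<tau>_def)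
  have W: "admissible A vP p0 (W z)" if "legal z" for z
    unfolding W_def using admissible_polygonal[OF vP, of "\<sigma> z"] legal(1)[OF that] \<sigma>0[of z] U0 t1
    by (intro admissible_concat) (simp_all add: p1_def)
  have \<tau>_cong: "\<tau> z n = \<tau> z' n" if "\<And>k. k < n \<Longrightarrow> z k = z' k" for z z' n
    using leg_causal[OF that] by (simp add: \<tau>_def)
  \<comment> \<open>The pursuer's motion up to observation \<open>n + 1\<close> is fixed by the
    observations up to \<open>n\<close>, so the next stretch of the play can be chosen before the
    next observation is known.\<close>
  have Q_cong: "Q z t = Q z' t" if eq: "\<And>k. k \<le> n \<Longrightarrow> z k = z' k" and t: "t \<le> \<tau> z (Suc n)" for z z' n t
  proof -
    have "W z r = W z' r" if "r < t" for r
    proof (cases "r < t1")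
      case False
      have "polygonal_control A vP (\<sigma> z) (r - t1) = polygonal_control A vP (\<sigma> z') (r - t1)"
      proof (rule polygonal_control_cong[OF vP])
        fix m assume "leg_time vP (\<sigma> z) m \<le> r - t1"
        then have "\<tau> z m < \<tau> z (Suc n)" using that t by (simp add: \<tau>_def)
        then have "m < Suc n" using \<tau>_mono[of "Suc n" m z] by (meson leD not_less)
        then show "\<sigma> z (Suc m) = \<sigma> z' (Suc m)"
          using eq by (intro causal) auto
      qed (use False \<sigma>0 in auto)
      then show ?thesis by (simp add: W_def concat_control_def)
    qed (simp add: W_def concat_control_def)
    then show ?thesis
      unfolding Q_def by (intro ext motion_cong) auto
  qed
  \<comment> \<open>The observations made so far are continued as a constant, as if the evader stood
    still, to form a legal infinite sequence at every stage.\<close>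
  define I where "I n f \<longleftrightarrow> (case f of (u, z) \<Rightarrow> legal z \<and> evader_play A G vE \<gamma> (Q z) x u (\<tau> z n) \<and>
    (\<forall>k\<le>n. z k = motion vE x u (\<tau> z k)) \<and> (\<forall>k\<ge>n. z k = z n))" for n f
  define R where "R n f g \<longleftrightarrow> (case (f, g) of ((u, z), (u', z')) \<Rightarrow>
    (\<forall>k\<le>n. z' k = z k) \<and> (\<forall>t\<in>{0..<\<tau> z n}. u' t = u t))" for n :: nat and f g :: "(real \<Rightarrow> plane) \<times> (nat \<Rightarrow> plane)"
  have "\<exists>f. \<forall>n. I n (f n) \<and> R n (f n) (f (Suc n))"
  proof (rule dependent_nat_choice)
    have "evader_play A G vE \<gamma> (Q (\<lambda>_. z1)) x u0 t1"
      by (rule evader_play_restrict[OF u0])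
        (use t1 in \<open>auto simp: Q_def W_def fun_eq_iff motion_concat_before\<close>)
    moreover have "legal (\<lambda>_. z1)"
      using z1 \<tau>_diff by (simp add: legal_def)
    moreover have "z1 = motion vE x u0 t1" by (fact z1_def)
    ultimately have "I 0 (u0, \<lambda>_. z1)"
      by (simp add: I_def \<tau>0)
    then show "\<exists>f. I 0 f" by blast
  next
    fix f n assume "I n f"
    then obtain u z where f: "f = (u, z)" and z: "legal z"
      and pl: "evader_play A G vE \<gamma> (Q z) x u (\<tau> z n)"
      and obs: "\<And>k. k \<le> n \<Longrightarrow> z k = motion vE x u (\<tau> z k)" and const: "\<And>k. n \<le> k \<Longrightarrow> z k = z n"
      by (cases f) (auto simp: I_def)
    \<comment> \<open>The winning condition supplies some continuation up to arrival. Only its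
      stretch until the next observation is kept, and the choice is made afresh at each
      stage.\<close>
    obtain u' s' where s': "\<tau> z n \<le> s'" and u': "\<And>t. t \<in> {0..<\<tau> z n} \<Longrightarrow> u' t = u t"
      and pl': "evader_play A G vE \<gamma> (Q z) x u' s'" and "motion vE x u' s' \<in> G"
      using guarantees_arrivalD(2)[OF win W[OF z]] pl unfolding Q_eq by blast
    then have arr: "motion vE x u' s' \<in> L"
      using arrival_in_L x by blast
    have cu': "control u'" using pl' by (simp add: evader_play_def)
    have mot: "motion vE x u' t = motion vE x u t" if "t \<le> \<tau> z n" for t
      using u' that by (intro motion_cong) auto
    have zn: "z n = motion vE x u' (\<tau> z n)"
      using obs[of n] mot by simp
    \<comment> \<open>An arrival before the next observation would contradict the margin
      \<open>\<epsilon>\<close> around \<open>L\<close>.\<close>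
    have late: "\<tau> z (Suc n) \<le> s'"
    proof (rule ccontr)
      assume "\<not> ?thesis"
      then have lt: "s' < \<tau> z (Suc n)" by simp
      have "norm (motion vE x u' s' - z n) \<le> vE * (s' - \<tau> z n)"
        unfolding zn using cu' v \<tau>_ge s' by (intro motion_lipschitz) auto
      also have "\<dots> \<le> vE * (\<tau> z (Suc n) - \<tau> z n)"
        using lt v by (intro mult_left_mono) auto
      finally show False using legal(4)[OF z arr, of n] \<epsilon> by simp
    qed
    define z' where "z' k = (if k \<le> n then z k else motion vE x u' (\<tau> z (Suc n)))" for k
    have same: "\<And>k. k \<le> n \<Longrightarrow> z k = z' k" by (simp add: z'_def)
    have \<tau>': "\<tau> z' k = \<tau> z k" if "k \<le> Suc n" for k
      using same that by (intro \<tau>_cong) auto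
    have pl'': "evader_play A G vE \<gamma> (Q z') x u' (\<tau> z' (Suc n))"
      using late \<tau>_ge Q_cong[OF same] \<tau>'[of "Suc n"]
      by (intro evader_play_restrict[OF pl']) auto
    have "legal z'"
      unfolding legal_def
    proof (intro conjI allI)
      show "z' 0 = z1" using z by (simp add: z'_def legal_def)
      show "z' k \<in> A" for k
        using z pl' late \<tau>_ge by (auto simp: z'_def legal_def evader_play_def)
      show "norm (z' (Suc k) - z' k) \<le> vE * (\<tau> z' (Suc k) - \<tau> z' k)" for k
      proof -
        consider "k < n" | "k = n" | "n < k" by linarith
        then show ?thesis
        proof cases
          case 1
          then show ?thesis using z \<tau>' by (simp add: z'_def legal_def)
        next
          case 2
          have "norm (motion vE x u' (\<tau> z (Suc n)) - motion vE x u' (\<tau> z n)) \<le> vE * (\<tau> z (Suc n) - \<tau> z n)"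
            using cu' v \<tau>_ge \<tau>_mono by (intro motion_lipschitz) auto
          with 2 show ?thesis using \<tau>' zn by (simp add: z'_def)
        next
          case 3
          then show ?thesis using \<tau>_diff[of z' k] by (simp add: z'_def)
        qed
      qed
    qed
    moreover have "z' k = motion vE x u' (\<tau> z' k)" if "k \<le> Suc n" for k
      using that obs[of k] \<tau>' mot[OF \<tau>_mono, of k] by (cases "k = Suc n") (auto simp: z'_def)
    moreover have "z' k = z' (Suc n)" if "Suc n \<le> k" for k
      using that by (simp add: z'_def)
    ultimately have "I (Suc n) (u', z')"
      using pl'' unfolding I_def by simp
    moreover have "R n f (u', z')"
      using same u' by (simp add: R_def f)
    ultimately show "\<exists>g. I (Suc n) g \<and> R n f g" by blast
  qed
  then obtain f where I: "\<And>n. I n (f n)" and R: "\<And>n. R n (f n) (f (Suc n))" by blast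
  define us where "us n = fst (f n)" for n
  define zs where "zs n = snd (f n)" for n
  have f: "f n = (us n, zs n)" for n by (simp add: us_def zs_def)
  have legal_n: "legal (zs n)" and play_n: "evader_play A G vE \<gamma> (Q (zs n)) x (us n) (\<tau> (zs n) n)"
    and obs_n: "zs n n = motion vE x (us n) (\<tau> (zs n) n)" for n
    using I[of n] by (auto simp: I_def f)
  have next_z: "zs (Suc n) k = zs n k" if "k \<le> n" for n k
    using R[of n] that by (auto simp: R_def f)
  have next_u: "us (Suc n) t = us n t" if "0 \<le> t" "t < \<tau> (zs n) n" for n t
    using R[of n] that by (auto simp: R_def f)
  define z where "z k = zs k k" for k
  have z: "zs n k = z k" if "k \<le> n" for n k
    using that
  proof (induction n rule: dec_induct)
    case (step n)
    with next_z[of k n] show ?case by simp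
  qed (simp add: z_def)
  have \<tau>z: "\<tau> (zs n) k = \<tau> z k" if "k \<le> Suc n" for n k
    using z that by (intro \<tau>_cong) auto
  have us: "us m t = us n t" if "n \<le> m" "0 \<le> t" "t < \<tau> z n" for m n t
    using that(1)
  proof (induction m rule: dec_induct)
    case (step m)
    have "t < \<tau> z m" using that(3) \<tau>_mono[of n m z] step.hyps by simp
    then have "us (Suc m) t = us m t"
      using next_u[of t m] that \<tau>z[of m m] by simp
    with step.IH show ?case by simp
  qed simp
  have "legal z"
    unfolding legal_def
  proof (intro conjI allI)
    show "z 0 = z1" using legal_n[of 0] by (simp add: legal_def z_def)
    show "z n \<in> A" for n using legal_n[of n] by (simp add: legal_def z_def)
    show "norm (z (Suc n) - z n) \<le> vE * (\<tau> z (Suc n) - \<tau> z n)" for n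
    proof -
      have "norm (zs (Suc n) (Suc n) - zs (Suc n) n) \<le> vE * (\<tau> (zs (Suc n)) (Suc n) - \<tau> (zs (Suc n)) n)"
        using legal_n[of "Suc n"] by (simp add: legal_def)
      then show ?thesis
        by (simp add: z \<tau>z)
    qed
  qed
  obtain B where B: "\<And>n. leg_time vP (\<sigma> z) n \<le> B" using legal(2)[OF \<open>legal z\<close>] by blast
  define t2 where "t2 = lim (leg_time vP (\<sigma> z))"
  note lim = polygonal_limit[OF vP B, folded t2_def]
  have t2: "0 \<le> t2" using lim(2)[of 0] by simp
  have \<tau>_lim: "\<tau> z \<longlonglongrightarrow> t1 + t2"
    unfolding \<tau>_def using lim(1) by (intro tendsto_intros)
  \<comment> \<open>Later stages keep the earlier stretches, so any stage that has passed
    \<open>t\<close> gives the same value. Countably many pieces keep \<open>u\<close> measurable,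
    and beyond the limit time a fixed unit vector fills in.\<close>
  define u where "u t = (if \<exists>n. t < \<tau> z n then us (LEAST n. t < \<tau> z n) t else (1, 0))" for t
  have u: "u t = us n t" if "0 \<le> t" "t < \<tau> z n" for t n
  proof -
    have 1: "t < \<tau> z (LEAST n. t < \<tau> z n)" by (rule LeastI) fact
    moreover have "(LEAST n. t < \<tau> z n) \<le> n" by (rule Least_le) fact
    ultimately have "us n t = us (LEAST n. t < \<tau> z n) t"
      using that by (intro us) auto
    with that show ?thesis by (auto simp: u_def)
  qed
  have "control u"
  proof -
    have less: "{t. t < b} \<in> sets lebesgue" for b :: real
      using lessThan_borel[of b] by (auto simp: lessThan_def)
    have cus: "control (us n)" for n using play_n[of n] by (simp add: evader_play_def)
    have idx: "(\<lambda>t. LEAST n. t < \<tau> z n) \<in> measurable lebesgue (count_space UNIV)"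
      by (rule measurable_Least) (use less in \<open>auto simp: pred_def\<close>)
    have "(\<lambda>t. us (LEAST n. t < \<tau> z n) t) \<in> borel_measurable lebesgue"
      by (rule measurable_compose_countable[OF _ idx]) (use cus in \<open>simp add: control_def\<close>)
    moreover have "{t. \<exists>n. t < \<tau> z n} \<in> sets lebesgue"
    proof -
      have "{t. \<exists>n. t < \<tau> z n} = (\<Union>n. {t. t < \<tau> z n})" by blast
      with less show ?thesis by auto
    qed
    ultimately have "u \<in> borel_measurable lebesgue"
      unfolding u_def by (intro measurable_If) auto
    moreover have "norm (u t) = 1" for t
      using cus by (simp add: u_def control_def norm_prod_def)
    ultimately show ?thesis by (simp add: control_def)
  qed
  have mot: "motion vE x u t = motion vE x (us n) t" if "t \<le> \<tau> z n" for t n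
    using u that by (intro motion_cong) auto
  have obs: "motion vE x u (\<tau> z n) = z n" for n
    using mot[of "\<tau> z n" n] obs_n[of n] \<tau>z[of n n] by (simp add: z_def)
  have z_lim: "z \<longlonglongrightarrow> motion vE x u (t1 + t2)"
  proof -
    have "(\<lambda>n. motion vE x u (\<tau> z n)) \<longlonglongrightarrow> motion vE x u (t1 + t2)"
      using \<tau>_ge t1 t2 v \<open>control u\<close>
      by (intro continuous_on_tendsto_compose[OF continuous_on_motion \<tau>_lim]) auto
    then show ?thesis by (simp add: obs)
  qed
  have before: "\<exists>n. t < \<tau> z n" if "t < t1 + t2" for t
    using order_tendstoD(1)[OF \<tau>_lim that] by (auto simp: eventually_sequentially)
  \<comment> \<open>No single stage reaches the limit time, but the feedback equation is required
    only before it, and closedness of \<open>A\<close> takes care of the final position.\<close>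
  have "evader_play A G vE \<gamma> (Q z) x u (t1 + t2)"
    unfolding evader_play_def
  proof (intro conjI ballI)
    fix t assume t: "t \<in> {0..<t1 + t2}"
    then obtain n where n: "t < \<tau> z n" using before by auto
    have "Q z t = Q (zs n) t"
      using n \<tau>_mono[of n "Suc n" z] z by (intro Q_cong[of n]) auto
    then show "motion vE x u t \<notin> G" "u t = \<gamma> (Q z t) (motion vE x u t)"
      using play_n[of n] t n mot[of t n] u[of t n] \<tau>z[of n n] by (auto simp: evader_play_def)
  next
    fix t assume t: "t \<in> {0..t1 + t2}"
    show "motion vE x u t \<in> A"
    proof (cases "t = t1 + t2")
      case True
      then show ?thesis
        using closed_sequentially[OF closed _ z_lim] \<open>legal z\<close> by (simp add: legal_def)
    next
      case False
      with t before obtain n where n: "t < \<tau> z n" by force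
      then show ?thesis
        using play_n[of n] t mot[of t n] \<tau>z[of n n] by (auto simp: evader_play_def)
    qed
  qed (use t1 t2 \<open>control u\<close> in auto)
  then have "motion vP p0 (W z) (t1 + t2) \<noteq> motion vE x u (t1 + t2)"
    using guarantees_arrivalD(1)[OF win W[OF \<open>legal z\<close>]] t1 t2 unfolding Q_eq by fastforce
  moreover have "motion vP p0 (W z) (t1 + t2) = motion vE x u (t1 + t2)"
  proof (rule LIMSEQ_unique)
    have "motion vP p0 (W z) (t1 + t2) = motion vP (\<sigma> z 0) (polygonal_control A vP (\<sigma> z)) t2"
      unfolding W_def using motion_concat_after[OF cU0 control_polygonal[OF vP] t1, of "t1 + t2"] t2
      by (simp add: \<sigma>0 p1_def)
    with lim(4) show "\<sigma> z \<longlonglongrightarrow> motion vP p0 (W z) (t1 + t2)" by simp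
    show "\<sigma> z \<longlonglongrightarrow> motion vE x u (t1 + t2)"
      using tendsto_add[OF legal(3)[OF \<open>legal z\<close>] z_lim] by simp
  qed
  ultimately show False by contradiction
qed

end


text \<open>In terms of \<open>D = T - T0\<close> the difference of the squares is a nonnegative
  quadratic term plus \<open>2 * (1 - \<mu>)\<close> times the first-order term, nonnegative by
  \<open>tie_first_order\<close>; the constant term vanishes by the tie.\<close>

lemma tie_propagates:
  fixes L :: "'a::real_inner set"
  assumes L: "convex L" "T0 \<in> L" and ab: "0 < a" "a < b"
    and tie: "b * norm (T0 - z) = a * norm (T0 - h)"
    and le: "\<And>T. T \<in> L \<Longrightarrow> a * norm (T - h) \<le> b * norm (T - z)"
    and \<mu>: "\<mu> \<le> 1" and T: "T \<in> L"
  shows "a * norm (T - (h + \<mu> *\<^sub>R (T0 - h))) \<le> b * norm (T - (z + \<mu> *\<^sub>R (T0 - z)))"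
proof -
  define D where "D = T - T0"
  define Y where "Y = T0 - z"
  define W where "W = T0 - h"
  have eqs: "T - (z + \<mu> *\<^sub>R Y) = D + (1 - \<mu>) *\<^sub>R Y" "T - (h + \<mu> *\<^sub>R W) = D + (1 - \<mu>) *\<^sub>R W"
    by (simp_all add: D_def Y_def W_def algebra_simps)
  have tie2: "b\<^sup>2 * (Y \<bullet> Y) = a\<^sup>2 * (W \<bullet> W)"
    using tie unfolding Y_def W_def power2_norm_eq_inner[symmetric] power_mult_distrib[symmetric] by simp
  have "b\<^sup>2 * (norm (D + (1 - \<mu>) *\<^sub>R Y))\<^sup>2 - a\<^sup>2 * (norm (D + (1 - \<mu>) *\<^sub>R W))\<^sup>2
      = (b\<^sup>2 - a\<^sup>2) * (norm D)\<^sup>2 + 2 * (1 - \<mu>) * (D \<bullet> (b\<^sup>2 *\<^sub>R Y - a\<^sup>2 *\<^sub>R W))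
        + (1 - \<mu>)\<^sup>2 * (b\<^sup>2 * (Y \<bullet> Y) - a\<^sup>2 * (W \<bullet> W))"
    unfolding power2_norm_eq_inner
    by (simp add: inner_add_left inner_add_right inner_diff_right inner_commute
        power2_eq_square algebra_simps)
  moreover have "0 \<le> (b\<^sup>2 - a\<^sup>2) * (norm D)\<^sup>2"
    using ab by (simp add: power_mono)
  moreover have "0 \<le> D \<bullet> (b\<^sup>2 *\<^sub>R Y - a\<^sup>2 *\<^sub>R W)"
    unfolding D_def Y_def W_def using tie_first_order[OF L T _ ab(2) tie le] ab by simp
  then have "0 \<le> 2 * (1 - \<mu>) * (D \<bullet> (b\<^sup>2 *\<^sub>R Y - a\<^sup>2 *\<^sub>R W))"
    using \<mu> by simp
  ultimately have "(a * norm (D + (1 - \<mu>) *\<^sub>R W))\<^sup>2 \<le> (b * norm (D + (1 - \<mu>) *\<^sub>R Y))\<^sup>2"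
    unfolding power_mult_distrib tie2 diff_self mult_zero_right by linarith
  then show ?thesis
    unfolding Y_def[symmetric] W_def[symmetric] eqs using ab by (auto intro: power2_le_imp_le)
qed

section \<open>The tie under feedback and the formula for the barrier\<close>

context reach_avoid
begin

lemma tie_not_evasion:
  assumes x: "x \<in> S" and p0: "p0 \<in> A" and T0: "T0 \<in> L"
    and tie: "vP * norm (T0 - x) = vE * norm (T0 - p0)"
    and le: "\<And>T. T \<in> L \<Longrightarrow> vE * norm (T - p0) \<le> vP * norm (T - x)"
  shows "x \<notin> evasion_winning_region A G S vP vE (\<lambda>_::unit. p0)"
proof
  assume "x \<in> evasion_winning_region A G S vP vE (\<lambda>_::unit. p0)"
  then obtain \<gamma> where win: "guarantees_arrival A G vP vE \<gamma> p0 x"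
    by (rule evasion_guarantee)
  define r where "r = norm (T0 - x)"
  define \<tau> where "\<tau> = r / vE"
  define eE where "eE = sgn (T0 - x)"
  define U where "U = straight vP p0 T0"
  have "x \<noteq> T0" using x T0 S L by auto
  then have r: "0 < r" and eE: "norm eE = 1" by (auto simp: r_def eE_def norm_sgn)
  have \<tau>: "0 < \<tau>" "vE * \<tau> = r" using r v by (auto simp: \<tau>_def)
  have tau_P: "norm (T0 - p0) = vP * \<tau>"
    using tie v by (simp add: \<tau>_def r_def field_simps)
  have reE: "(vE * t) *\<^sub>R eE = (t / \<tau>) *\<^sub>R (T0 - x)" for t
    using r v by (simp add: \<tau>_def eE_def sgn_div_norm divide_inverse flip: r_def)
  have U: "admissible A vP p0 U"
    unfolding U_def using p0 T0 L by (intro admissible_straight vP) auto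
  have motU: "motion vP p0 U t = p0 + (t / \<tau>) *\<^sub>R (T0 - p0)" if "0 \<le> t" "t \<le> \<tau>" for t
    using motion_straight[of vP t T0 p0] that vP \<tau>
    by (simp add: U_def tau_P sgn_div_norm field_simps)
  \<comment> \<open>The play of length 0 exists trivially; its continuation to arrival is the play
    to be refuted.\<close>
  have "evader_play A G vE \<gamma> (\<lambda>t _. motion vP p0 U t) x (\<lambda>_. eE) 0"
    using x S eE by (auto simp: evader_play_def control_constant)
  from guarantees_arrivalD(2)[OF win U this] obtain u s
    where pl: "evader_play A G vE \<gamma> (\<lambda>t _. motion vP p0 U t) x u s"
    and arr: "motion vE x u s \<in> G"
    by blast
  have free: "motion vP p0 U t \<noteq> motion vE x u t" if "t \<in> {0..s}" for t
    using guarantees_arrivalD(1)[OF win U pl] that by blast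
  have cu: "control u" and s: "0 \<le> s" using pl by (auto simp: evader_play_def)
  define f where "f t = motion vE x u t - (x + (vE * t) *\<^sub>R eE)" for t
  \<comment> \<open>An evader that never leaves the straight course either ends short of
    \<open>G\<close> or meets the pursuer at \<open>T0\<close>.\<close>
  have "\<exists>a. 0 \<le> a \<and> a \<le> s \<and> a \<le> \<tau> \<and> f a \<noteq> 0"
  proof (rule ccontr)
    assume "\<not> ?thesis"
    then have straight: "motion vE x u t = x + (vE * t) *\<^sub>R eE" if "0 \<le> t" "t \<le> s" "t \<le> \<tau>" for t
      using that by (auto simp: f_def)
    show False
    proof (cases "s < \<tau>")
      case True
      then have "motion vE x u s = x + (s / \<tau>) *\<^sub>R (T0 - x)"
        using straight[of s] s reE by simp
      moreover have "x + (s / \<tau>) *\<^sub>R (T0 - x) \<notin> G"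
        using True s \<tau> by (intro sight x T0) auto
      ultimately show False using arr by simp
    next
      case False
      then have "motion vE x u \<tau> = T0" "motion vP p0 U \<tau> = T0"
        using straight[of \<tau>] motU[of \<tau>] reE[of \<tau>] \<tau> by auto
      with free[of \<tau>] False \<tau> show False by simp
    qed
  qed
  then obtain a where a: "0 \<le> a" "a \<le> s" "a \<le> \<tau>" "f a \<noteq> 0" by blast
  have cont: "continuous_on {0..a} f"
    unfolding f_def using cu v
    by (intro continuous_intros continuous_on_subset[OF continuous_on_motion]) auto
  \<comment> \<open>The last time on course before \<open>a\<close> is isolated because
    \<open>tie_deviation\<close> needs a short time \<open>\<eta>\<close>: after it every time up to
    \<open>a\<close> is off course, so \<open>\<eta>\<close> may be chosen as small as
    required.\<close>
  define Z where "Z = {t \<in> {0..a}. f t = 0}"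
  have "compact Z"
  proof -
    have "closed Z"
      unfolding Z_def by (rule continuous_closed_preimage_constant[OF cont]) simp
    then have "compact ({0..a} \<inter> Z)" by (intro compact_Int_closed) auto
    moreover have "{0..a} \<inter> Z = Z" by (auto simp: Z_def)
    ultimately show ?thesis by simp
  qed
  moreover have "0 \<in> Z" using a by (simp add: Z_def f_def)
  ultimately obtain t0 where t0: "t0 \<in> Z" "\<And>t. t \<in> Z \<Longrightarrow> t \<le> t0"
    using compact_attains_sup[of Z] by blast
  have t0': "0 \<le> t0" "t0 < a" "f t0 = 0"
    using t0(1) a(4) by (auto simp: Z_def less_le)
  define \<mu> where "\<mu> = t0 / \<tau>"
  define z where "z = x + \<mu> *\<^sub>R (T0 - x)"
  define h where "h = p0 + \<mu> *\<^sub>R (T0 - p0)"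
  have \<mu>: "0 \<le> \<mu>" "\<mu> < 1" using t0' a \<tau> by (auto simp: \<mu>_def)
  have z: "T0 - z = (1 - \<mu>) *\<^sub>R (T0 - x)" and h: "T0 - h = (1 - \<mu>) *\<^sub>R (T0 - p0)"
    by (simp_all add: z_def h_def algebra_simps)
  have mz: "motion vE x u t0 = z"
    using t0' reE by (simp add: f_def z_def \<mu>_def)
  have nz: "norm (T0 - z) = (1 - \<mu>) * r"
    using \<mu> by (simp add: z r_def)
  define c where "c = vP\<^sup>2 - vE\<^sup>2"
  have c: "0 < c" using v by (simp add: c_def power_strict_mono)
  \<comment> \<open>The factor 2 makes the bound demanded by \<open>tie_deviation\<close>
    strict.\<close>
  define \<eta> where "\<eta> = min (a - t0) (c * norm (T0 - z) / (2 * (vP\<^sup>2 * vE)))"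
  have \<eta>: "0 < \<eta>" "\<eta> \<le> a - t0" "vP\<^sup>2 * (vE * \<eta>) < c * norm (T0 - z)"
  proof -
    have pos: "0 < c * norm (T0 - z)" using c nz \<mu> r by simp
    then show "0 < \<eta>" using t0' v by (simp add: \<eta>_def)
    show "\<eta> \<le> a - t0" by (simp add: \<eta>_def)
    have "\<eta> \<le> c * norm (T0 - z) / (2 * (vP\<^sup>2 * vE))" by (simp add: \<eta>_def)
    then have "2 * (vP\<^sup>2 * (vE * \<eta>)) \<le> c * norm (T0 - z)"
      using v by (simp add: pos_le_divide_eq mult_ac)
    with pos show "vP\<^sup>2 * (vE * \<eta>) < c * norm (T0 - z)" by linarith
  qed
  define t1 where "t1 = t0 + \<eta>"
  have t1: "t0 < t1" "t1 \<le> a" using \<eta> by (auto simp: t1_def)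
  define d where "d = motion vE x u t1 - motion vE x u t0"
  have d1: "norm d \<le> vE * \<eta>"
    unfolding d_def using motion_lipschitz[OF cu, of vE t0 t1 x] v t0' t1 by (simp add: t1_def)
  have "f t1 \<noteq> 0"
    using t0(2)[of t1] t1 t0' by (force simp: Z_def)
  moreover have "sgn (T0 - z) = eE"
    using \<mu> by (simp add: z sgn_scaleR eE_def)
  moreover have "f t1 = f t0 + (d - (vE * \<eta>) *\<^sub>R eE)"
    by (simp add: f_def d_def t1_def algebra_simps)
  ultimately have d2: "d \<noteq> (vE * \<eta>) *\<^sub>R sgn (T0 - z)"
    using t0' by auto
  have tie': "vP * norm (T0 - z) = vE * norm (T0 - h)"
    using tie \<mu> by (simp add: z h mult.left_commute)
  have le': "vE * norm (T - h) \<le> vP * norm (T - z)" if "T \<in> L" for T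
    unfolding z_def h_def
    by (rule tie_propagates[OF L(2) T0 v tie le _ that]) (use \<mu> in simp_all)
  have mP: "motion vP p0 U t1 = h + (vP * \<eta>) *\<^sub>R sgn (T0 - h)"
  proof -
    have "sgn (T0 - h) = sgn (T0 - p0)" using \<mu> by (simp add: h sgn_scaleR)
    then have "(vP * \<eta>) *\<^sub>R sgn (T0 - h) = (\<eta> / \<tau>) *\<^sub>R (T0 - p0)"
      using vP \<tau> by (simp add: sgn_div_norm tau_P divide_inverse)
    moreover have "motion vP p0 U t1 = p0 + (t1 / \<tau>) *\<^sub>R (T0 - p0)"
      using t1 t0' a by (intro motU) auto
    ultimately show ?thesis
      by (simp add: h_def \<mu>_def t1_def add_divide_distrib scaleR_left_distrib)
  qed
  have mE: "motion vE x u t1 = z + d" by (simp add: d_def mz)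
  have "vE * norm (T - motion vP p0 U t1) < vP * norm (T - motion vE x u t1)" if "T \<in> L" for T
    unfolding mP mE
    using tie_deviation[OF L(2) T0 v tie' le' \<eta>(1) \<eta>(3)[unfolded c_def] d1 d2 that] by simp
  moreover have "evader_play A G vE \<gamma> (\<lambda>t _. motion vP p0 U t) x u t1"
    using t1 t0' a by (intro evader_play_restrict[OF pl]) auto
  ultimately show False
    using feedback_capture[OF x win U] by blast
qed

lemma game_barrier_eq:
  assumes p0: "p0 \<in> A"
  shows "game_barrier A G S vP vE (\<lambda>_::unit. p0) =
    {x \<in> S. (\<forall>T\<in>L. vE * norm (T - p0) \<le> vP * norm (T - x)) \<and>
            (\<exists>T\<in>L. vP * norm (T - x) = vE * norm (T - p0))}"
proof (intro set_eqI iffI)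
  fix x assume x: "x \<in> game_barrier A G S vP vE (\<lambda>_::unit. p0)"
  then have xS: "x \<in> S" by (simp add: game_barrier_def)
  have "\<forall>T\<in>L. vE * norm (T - p0) \<le> vP * norm (T - x)"
    using x evasion_wins[OF xS, of _ p0] by (auto simp: game_barrier_def not_less[symmetric])
  moreover have "\<exists>T\<in>L. \<not> vE * norm (T - p0) < vP * norm (T - x)"
    using x pursuit_wins[OF xS p0] by (auto simp: game_barrier_def)
  ultimately show "x \<in> {x \<in> S. (\<forall>T\<in>L. vE * norm (T - p0) \<le> vP * norm (T - x)) \<and>
            (\<exists>T\<in>L. vP * norm (T - x) = vE * norm (T - p0))}"
    using xS by force
next
  fix x assume "x \<in> {x \<in> S. (\<forall>T\<in>L. vE * norm (T - p0) \<le> vP * norm (T - x)) \<and>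
            (\<exists>T\<in>L. vP * norm (T - x) = vE * norm (T - p0))}"
  then obtain T where x: "x \<in> S" and le: "\<And>T. T \<in> L \<Longrightarrow> vE * norm (T - p0) \<le> vP * norm (T - x)"
    and T: "T \<in> L" "vP * norm (T - x) = vE * norm (T - p0)" by blast
  show "x \<in> game_barrier A G S vP vE (\<lambda>_::unit. p0)"
    using x tie_not_pursuit[OF x T] tie_not_evasion[OF x p0 T le] by (simp add: game_barrier_def)
qed

end

section \<open>The base curves\<close>

text \<open>The vertex \<open>m / \<kappa>\<close> lies left of the interval, inside it or right of
  it, and the minimum is accordingly \<open>q 0\<close>, \<open>n - m^2 / \<kappa>\<close> or
  \<open>q l\<close>.\<close>

lemma quadratic_touches_zero:
  fixes \<kappa> m n l :: real
  assumes "0 < \<kappa>" "0 < l"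
  defines "q \<equiv> \<lambda>t. \<kappa> * t\<^sup>2 - 2 * m * t + n"
  shows "(\<forall>t\<in>{0..l}. 0 \<le> q t) \<and> (\<exists>t\<in>{0..l}. q t = 0) \<longleftrightarrow>
    m \<le> 0 \<and> n = 0 \<or> 0 < m \<and> m < \<kappa> * l \<and> \<kappa> * n = m\<^sup>2 \<or> \<kappa> * l \<le> m \<and> q l = 0"
proof -
  have touch: "(\<forall>t\<in>{0..l}. 0 \<le> q t) \<and> (\<exists>t\<in>{0..l}. q t = 0) \<longleftrightarrow> q s = 0"
    if "s \<in> {0..l}" "\<And>t. t \<in> {0..l} \<Longrightarrow> q s \<le> q t" for s
    using that by (metis order_antisym)
  consider "m \<le> 0" | "0 < m" "m < \<kappa> * l" | "\<kappa> * l \<le> m" by linarith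
  then show ?thesis
  proof cases
    case 1
    have "q 0 \<le> q t" if "t \<in> {0..l}" for t
    proof -
      have "0 \<le> \<kappa> * t\<^sup>2" "m * t \<le> 0"
        using that 1 assms(1) by (auto intro: mult_nonpos_nonneg)
      then show ?thesis by (simp add: q_def mult.assoc)
    qed
    with touch[of 0] have "(\<forall>t\<in>{0..l}. 0 \<le> q t) \<and> (\<exists>t\<in>{0..l}. q t = 0) \<longleftrightarrow> n = 0"
      using assms by (simp add: q_def)
    moreover have "m < \<kappa> * l" using 1 assms mult_pos_pos[of \<kappa> l] by linarith
    ultimately show ?thesis using 1 by auto
  next
    case 2
    have "q t - q (m / \<kappa>) = \<kappa> * (t - m / \<kappa>)\<^sup>2" for t
      using assms(1) by (simp add: q_def power2_eq_square field_simps)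
    moreover have "0 \<le> \<kappa> * (t - m / \<kappa>)\<^sup>2" for t using assms(1) by simp
    ultimately have "q (m / \<kappa>) \<le> q t" for t by (metis diff_ge_0_iff_ge)
    moreover have "m / \<kappa> \<in> {0..l}" using 2 assms(1) by (simp add: field_simps)
    moreover have "q (m / \<kappa>) = 0 \<longleftrightarrow> \<kappa> * n = m\<^sup>2"
    proof -
      have "\<kappa> * q (m / \<kappa>) = \<kappa> * n - m\<^sup>2"
        using assms(1) by (simp add: q_def power2_eq_square field_simps)
      then show ?thesis using assms(1) by (metis eq_iff_diff_eq_0 mult_eq_0_iff less_irrefl)
    qed
    ultimately have "(\<forall>t\<in>{0..l}. 0 \<le> q t) \<and> (\<exists>t\<in>{0..l}. q t = 0) \<longleftrightarrow> \<kappa> * n = m\<^sup>2"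
      using touch[of "m / \<kappa>"] by blast
    then show ?thesis using 2 by auto
  next
    case 3
    have "q l \<le> q t" if "t \<in> {0..l}" for t
    proof -
      have "q t - q l = (l - t) * (2 * m - \<kappa> * (t + l))"
        by (simp add: q_def power2_eq_square algebra_simps)
      moreover have "\<kappa> * (t + l) \<le> \<kappa> * (2 * l)"
        using that assms(1) by (intro mult_left_mono) auto
      ultimately have "0 \<le> (l - t) * (2 * m - \<kappa> * (t + l))"
        using that 3 by (intro mult_nonneg_nonneg) auto
      then show ?thesis
        using \<open>q t - q l = _\<close> by simp
    qed
    with touch[of l] have "(\<forall>t\<in>{0..l}. 0 \<le> q t) \<and> (\<exists>t\<in>{0..l}. q t = 0) \<longleftrightarrow> q l = 0"
      using assms by simp
    moreover have "0 < m" using 3 assms mult_pos_pos[of \<kappa> l] by linarith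
    ultimately show ?thesis using 3 by auto
  qed
qed

lemma target_line_eq: "0 < l \<Longrightarrow> target_line l = (\<lambda>t. (t, 0)) ` {0..l}"
proof (intro set_eqI iffI)
  fix z assume "z \<in> target_line l" and l: "0 < l"
  then obtain c where "0 \<le> c" "c \<le> 1" "z = (c * l, 0)"
    by (auto simp: target_line_def in_segment)
  then show "z \<in> (\<lambda>t. (t, 0)) ` {0..l}"
    using l by (auto intro!: image_eqI[of _ _ "c * l"] mult_left_le_one_le)
next
  fix z :: plane assume l: "0 < l" and "z \<in> (\<lambda>t. (t, 0)) ` {0..l}"
  then obtain t where t: "0 \<le> t" "t \<le> l" "z = (t, 0)" by auto
  then show "z \<in> target_line l"
    using l by (auto simp: target_line_def in_segment intro!: exI[of _ "t / l"])
qed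

lemma norm_eq_scaled_iff:
  assumes "0 \<le> \<alpha>"
  shows "norm (x :: 'a::real_normed_vector) = \<alpha> * norm (y :: 'b::real_normed_vector)
    \<longleftrightarrow> (norm x)\<^sup>2 = \<alpha>\<^sup>2 * (norm y)\<^sup>2"
  using assms by (simp add: power2_eq_iff_nonneg flip: power_mult_distrib)

lemma base_curves_eq:
  assumes l: "0 < l" and \<alpha>: "0 < \<alpha>" "\<alpha> < 1"
  shows "{z. snd z < 0 \<and> (\<forall>T\<in>target_line l. \<alpha> * norm (T - h) \<le> norm (T - z)) \<and>
      (\<exists>T\<in>target_line l. norm (T - z) = \<alpha> * norm (T - h))} =
    base_curve1 \<alpha> h \<union> base_curve2 \<alpha> l h \<union> base_curve3 \<alpha> l h"
proof (intro set_eqI)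
  fix z :: plane
  obtain x y where z: "z = (x, y)" by (cases z)
  obtain a b where h: "h = (a, b)" by (cases h)
  \<comment> \<open>Coefficients of the difference of the squared distances on the axis, as a
    polynomial in \<open>t\<close>. The position of its vertex relative to the target line is the
    position of \<open>x\<close> relative to \<open>k1\<close> and \<open>k2\<close>.\<close>
  define \<kappa> where "\<kappa> = 1 - \<alpha>\<^sup>2"
  define m where "m = x - \<alpha>\<^sup>2 * a"
  define n where "n = x\<^sup>2 + y\<^sup>2 - \<alpha>\<^sup>2 * (a\<^sup>2 + b\<^sup>2)"
  define q where "q t = \<kappa> * t\<^sup>2 - 2 * m * t + n" for t
  have \<kappa>: "0 < \<kappa>" using \<alpha> by (simp add: \<kappa>_def power_less_one_iff)
  have sq: "(norm ((t, 0) - z))\<^sup>2 = (t - x)\<^sup>2 + y\<^sup>2" "(norm ((t, 0) - h))\<^sup>2 = (t - a)\<^sup>2 + b\<^sup>2" for t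
    by (simp_all add: z h norm_prod_def)
  have q: "q t = (norm ((t, 0) - z))\<^sup>2 - \<alpha>\<^sup>2 * (norm ((t, 0) - h))\<^sup>2" for t
    unfolding sq q_def \<kappa>_def m_def n_def by (simp add: power2_eq_square algebra_simps)
  have eq: "norm ((t, 0) - z) = \<alpha> * norm ((t, 0) - h) \<longleftrightarrow> q t = 0" for t
    unfolding norm_eq_scaled_iff[OF less_imp_le[OF \<alpha>(1)]] q by simp
  have eq': "norm (z - (t, 0)) = \<alpha> * norm (h - (t, 0)) \<longleftrightarrow> q t = 0" for t
    using eq[of t] by (simp only: norm_minus_commute)
  have ge: "\<alpha> * norm ((t, 0) - h) \<le> norm ((t, 0) - z) \<longleftrightarrow> 0 \<le> q t" for t
  proof -
    have "\<alpha> * norm ((t, 0) - h) \<le> norm ((t, 0) - z) \<longleftrightarrow>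
        (\<alpha> * norm ((t, 0) - h))\<^sup>2 \<le> (norm ((t, 0) - z))\<^sup>2"
      using \<alpha> by simp
    then show ?thesis unfolding q power_mult_distrib by linarith
  qed
  have "z \<in> {z. snd z < 0 \<and> (\<forall>T\<in>target_line l. \<alpha> * norm (T - h) \<le> norm (T - z)) \<and>
      (\<exists>T\<in>target_line l. norm (T - z) = \<alpha> * norm (T - h))} \<longleftrightarrow>
    y < 0 \<and> (\<forall>t\<in>{0..l}. 0 \<le> q t) \<and> (\<exists>t\<in>{0..l}. q t = 0)"
    by (simp add: target_line_eq[OF l] ge eq) (simp add: z)
  also have "\<dots> \<longleftrightarrow> y < 0 \<and> (m \<le> 0 \<and> n = 0 \<or> 0 < m \<and> m < \<kappa> * l \<and> \<kappa> * n = m\<^sup>2 \<or> \<kappa> * l \<le> m \<and> q l = 0)"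
    using quadratic_touches_zero[OF \<kappa> l, of m n] by (simp add: q_def)
  also have "\<dots> \<longleftrightarrow> z \<in> base_curve1 \<alpha> h \<union> base_curve2 \<alpha> l h \<union> base_curve3 \<alpha> l h"
  proof -
    have "z \<in> base_curve1 \<alpha> h \<longleftrightarrow> y < 0 \<and> m \<le> 0 \<and> n = 0"
      using eq'[of 0] unfolding base_curve1_def k1_def z h by (auto simp: m_def q_def)
    moreover have "z \<in> base_curve3 \<alpha> l h \<longleftrightarrow> y < 0 \<and> \<kappa> * l \<le> m \<and> q l = 0"
      using eq'[of l] unfolding base_curve3_def k2_def z h by (auto simp: m_def \<kappa>_def)
    moreover have "z \<in> base_curve2 \<alpha> l h \<longleftrightarrow> y < 0 \<and> 0 < m \<and> m < \<kappa> * l \<and> \<kappa> * n = m\<^sup>2"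
    proof -
      \<comment> \<open>The equation of the second base curve is the discriminant condition
        \<open>\<kappa> * n = m^2\<close> divided by \<open>- \<alpha>^2\<close>.\<close>
      define E where "E = (x - a)\<^sup>2 + (1 - 1 / \<alpha>\<^sup>2) * y\<^sup>2 + \<kappa> * b\<^sup>2"
      have "\<alpha>\<^sup>2 * (1 - 1 / \<alpha>\<^sup>2) = \<alpha>\<^sup>2 - 1"
        using \<alpha> by (simp add: right_diff_distrib)
      then have "\<alpha>\<^sup>2 * E = \<alpha>\<^sup>2 * (x - a)\<^sup>2 + (\<alpha>\<^sup>2 - 1) * y\<^sup>2 + \<alpha>\<^sup>2 * (\<kappa> * b\<^sup>2)"
        unfolding E_def by (simp only: distrib_left mult.assoc[symmetric])
      then have "\<kappa> * n - m\<^sup>2 = - (\<alpha>\<^sup>2 * E)"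
        by (simp add: \<kappa>_def n_def m_def power2_eq_square algebra_simps)
      then have "\<kappa> * n = m\<^sup>2 \<longleftrightarrow> \<alpha>\<^sup>2 * E = 0" by linarith
      then have "\<kappa> * n = m\<^sup>2 \<longleftrightarrow> E = 0" using \<alpha> by simp
      then show ?thesis
        unfolding base_curve2_def z h k1_def k2_def E_def by (auto simp: m_def \<kappa>_def)
    qed
    ultimately show ?thesis by blast
  qed
  finally show "z \<in> {z. snd z < 0 \<and> (\<forall>T\<in>target_line l. \<alpha> * norm (T - h) \<le> norm (T - z)) \<and>
      (\<exists>T\<in>target_line l. norm (T - z) = \<alpha> * norm (T - h))} \<longleftrightarrow>
    z \<in> base_curve1 \<alpha> h \<union> base_curve2 \<alpha> l h \<union> base_curve3 \<alpha> l h" .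
qed

section \<open>The two games as instances\<close>

lemma target_line_level: "z \<in> target_line l \<Longrightarrow> snd z = 0"
  by (auto simp: target_line_def in_segment)

lemma play_region_eq: "play_region \<Omega> = {z \<in> \<Omega>. snd z < 0}"
  by (auto simp: play_region_def target_region_def)

lemma segment_point_below:
  fixes x T :: plane
  shows "snd x < 0 \<Longrightarrow> snd T = 0 \<Longrightarrow> s < 1 \<Longrightarrow> snd (x + s *\<^sub>R (T - x)) < 0"
proof -
  assume *: "snd x < 0" "snd T = 0" "s < 1"
  then have "snd (x + s *\<^sub>R (T - x)) = (1 - s) * snd x"
    by (simp add: algebra_simps)
  with * show ?thesis by (simp add: mult_pos_neg)
qed

text \<open>Here \<open>G\<close> and \<open>L\<close> coincide, so \<open>entry\<close> is
  immediate, and crossing the axis beside the segment is no arrival.\<close>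

lemma reach_avoid_free:
  assumes "0 < vE" "vE < vP" "0 < l"
  shows "reach_avoid UNIV (0, 0) (1, 0) (target_line l) {z. snd z < 0} (target_line l) vP vE"
proof
  fix \<phi> :: "real \<Rightarrow> plane" and s :: real
  assume "0 \<le> s" "\<phi> s \<in> target_line l"
  then show "\<exists>t\<in>{0..s}. \<phi> t \<in> target_line l" by auto
next
  fix x T :: plane and s :: real
  assume "x \<in> {z. snd z < 0}" "T \<in> target_line l" "s < 1"
  then show "x + s *\<^sub>R (T - x) \<notin> target_line l"
    using segment_point_below[of x T s] target_line_level[of T l]
      target_line_level[of "x + s *\<^sub>R (T - x)" l] by auto
next
  show "compact (target_line l)" "convex (target_line l)" by (simp_all add: target_line_def)
  show "{z. snd z < 0} \<inter> target_line l = {}" using target_line_level by fastforce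
qed (use assms in auto)

text \<open>\<open>entry\<close> is the intermediate value theorem for the second coordinate: within
  the domain the axis consists of the target line alone.\<close>

lemma reach_avoid_domain:
  assumes "0 < vE" "vE < vP" and \<Omega>: "game_domain \<Omega> l"
  shows "reach_avoid \<Omega> (0, 0) (l, 0) (target_region \<Omega>) (play_region \<Omega>) (target_line l) vP vE"
proof
  have line: "target_line l = {z \<in> \<Omega>. snd z = 0}" and l: "0 < l"
    using \<Omega> by (auto simp: game_domain_def)
  have ends: "(0, 0) \<in> target_line l" "(l, 0) \<in> target_line l"
    by (simp_all add: target_line_def)
  show "convex \<Omega>" "closed \<Omega>" using \<Omega> by (auto simp: game_domain_def compact_imp_closed)
  show "(0, 0) \<in> \<Omega>" "(l, 0) \<in> \<Omega>" using ends line by auto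
  show "(0, 0) \<noteq> (l, 0)" using l by simp
  show "compact (target_line l)" "convex (target_line l)" by (simp_all add: target_line_def)
  show "target_line l \<subseteq> target_region \<Omega>" "target_line l \<subseteq> \<Omega>"
    using line by (auto simp: target_region_def)
  show "play_region \<Omega> \<subseteq> \<Omega>" "play_region \<Omega> \<inter> target_region \<Omega> = {}"
    by (auto simp: play_region_def)
  fix \<phi> :: "real \<Rightarrow> plane" and s :: real
  assume s: "0 \<le> s" and cont: "continuous_on {0..s} \<phi>" and in_\<Omega>: "\<phi> ` {0..s} \<subseteq> \<Omega>"
    and ends: "\<phi> 0 \<in> play_region \<Omega>" "\<phi> s \<in> target_region \<Omega>"
  have "\<exists>t. 0 \<le> t \<and> t \<le> s \<and> snd (\<phi> t) = 0"
    using s ends by (intro IVT' continuous_on_snd cont) (auto simp: play_region_eq target_region_def)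
  then obtain t where "t \<in> {0..s}" "snd (\<phi> t) = 0" by auto
  then show "\<exists>t\<in>{0..s}. \<phi> t \<in> target_line l"
    using in_\<Omega> by (auto simp: line intro!: bexI[of _ t])
next
  fix x T :: plane and s :: real
  assume "x \<in> play_region \<Omega>" "T \<in> target_line l" "s < 1"
  then show "x + s *\<^sub>R (T - x) \<notin> target_region \<Omega>"
    using segment_point_below[of x T s] target_line_level[of T l]
    by (auto simp: play_region_eq target_region_def)
qed (use assms in auto)

theorem theorem1:
  fixes \<Omega> :: "plane set" and l vP vE \<alpha> :: real
    and xP xE :: "nat \<Rightarrow> plane" and Np Ne i j :: nat
  assumes "game_domain \<Omega> l"
    and "0 < vP" and "0 < vE" and "\<alpha> = vE / vP" and "\<alpha> \<in> {0<..<1}"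
    and "inj_on xP {1..Np}" and "inj_on xE {1..Ne}"
    and "xP ` {1..Np} \<inter> xE ` {1..Ne} = {}"
    and "\<And>a. a \<in> {1..Np} \<Longrightarrow> xP a \<in> play_region \<Omega> \<union> target_line l"
    and "\<And>b. b \<in> {1..Ne} \<Longrightarrow> xE b \<in> play_region \<Omega>"
    and "i \<in> {1..Np}" and "j \<in> {1..Ne}"
  shows "barrier \<Omega> vP vE (\<lambda>_::unit. xP i) =
           free_barrier l vP vE (\<lambda>_::unit. xP i) \<inter> play_region \<Omega> \<and>
         free_barrier l vP vE (\<lambda>_::unit. xP i) =
           base_curve1 \<alpha> (xP i) \<union> base_curve2 \<alpha> l (xP i) \<union> base_curve3 \<alpha> l (xP i)"
proof -
  have v: "0 < vE" "vE < vP" and \<alpha>: "0 < \<alpha>" "\<alpha> < 1"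
    using assms(2-5) by (auto simp: field_simps)
  have l: "0 < l" and line: "target_line l \<subseteq> \<Omega>"
    using assms(1) by (auto simp: game_domain_def)
  have h: "xP i \<in> \<Omega>"
    using assms(9,11) line by (auto simp: play_region_def)
  have scale: "vE * s \<le> vP * t \<longleftrightarrow> \<alpha> * s \<le> t" "vP * t = vE * s \<longleftrightarrow> t = \<alpha> * s" for s t
    using assms(2,4) by (auto simp: field_simps)
  note free = reach_avoid.game_barrier_eq[OF reach_avoid_free[OF v l] UNIV_I, of "xP i"]
  note domain = reach_avoid.game_barrier_eq[OF reach_avoid_domain[OF v assms(1)] h]
  have "free_barrier l vP vE (\<lambda>_::unit. xP i) =
      base_curve1 \<alpha> (xP i) \<union> base_curve2 \<alpha> l (xP i) \<union> base_curve3 \<alpha> l (xP i)"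
    using base_curves_eq[OF l \<alpha>, of "xP i"] by (simp add: free_barrier_def free scale)
  moreover have "barrier \<Omega> vP vE (\<lambda>_::unit. xP i) =
      free_barrier l vP vE (\<lambda>_::unit. xP i) \<inter> play_region \<Omega>"
    unfolding barrier_def free_barrier_def free domain by (auto simp: play_region_eq)
  ultimately show ?thesis by blast
qed

end
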